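(* Consider the sequence of bandwidth sharing networks indexed by $\epsilon\in(0,1)$ described in the context, operated under a weighted proportionally fair policy, with exponential file size distributions and arrival rate vector $\bm\lambda^{(\epsilon)}=(1-\epsilon)\bm\lambda^{(0)}$, where under $\bm\lambda^{(0)}$ exactly the $L_s$ links in $\mathcal L_s$ are critically loaded. Let $\overline{\bm N}^{(\epsilon)}$ be a random vector distributed according to the stationary distribution of the flow count process $(\bm N^{(\epsilon)}(t):t\ge0)$, and let $\|\overline{\bm N}_\perp^{(\epsilon)}\|$ be its distance to the cone $\mathcal K$ in the norm induced by the weighted inner product of the context. Then for every nonnegative integer $m$, as $\epsilon\to0^+$, $$\mathbb E\Bigl[\bigl\|\overline{\bm N}^{(\epsilon)}_\perp\bigr\|^m\Bigr]=O\Bigl(\bigl(1/\sqrt\epsilon\bigr)^m\Bigr).$$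
   Context: **Network.** Links $\mathcal L=\{1,\dots,L\}$ with capacities $C_\ell>0$; routes $\mathcal R=\{1,\dots,R\}$, each route being a nonempty set of links ($\ell\in r$ means link $\ell$ is on route $r$). The routing matrix $H=(h_{\ell r})$, $h_{\ell r}=1$ if $\ell\in r$ and $0$ otherwise, has full row rank. Each route $r$ has a weight $\kappa_r>0$. **Weighted proportionally fair policy.** A state is $\bm n=(n_r)_{r\in\mathcal R}\in\mathbb Z_+^R$ ($n_r$ = number of flows on route $r$). In state $\bm n$ each flow on route $r$ gets rate $x_r=x_r(\bm n)$, where $(x_r)$ maximizes $\sum_r\kappa_rn_r\log x_r$ subject to $\sum_{r:\ell\in r}n_rx_r\le C_\ell$ for all $\ell$ and $x_r\ge0$, with $x_r=0$ when $n_r=0$. **Flow count process.** Flows arrive on route $r$ as independent Poisson processes of rate $\lambda_r$; file sizes on route $r$ are i.i.d. exponential with rate $\mu_r>0$, independent across routes. With $\bm e^{(r)}$ the standard basis vectors of $\mathbb R^R$, the flow count process is the continuous-time Markov chain on $\mathbb Z_+^R$ with transitions $\bm n\to\bm n+\bm e^{(r)}$ at rate $\lambda_r$ and $\bm n\to\bm n-\bm e^{(r)}$ at rate $n_rx_r\mu_r$. **Heavy traffic.** Fix $\bm\lambda^{(0)}$ with all $\lambda_r^{(0)}>0$ on the boundary of the capacity region: with $\rho_r^{(0)}=\lambda_r^{(0)}/\mu_r$, $\sum_{r:\ell\in r}\rho_r^{(0)}=C_\ell$ for $\ell$ in a nonempty set $\mathcal L_s\subseteq\mathcal L$ of critically loaded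 links and $\sum_{r:\ell\in r}\rho_r^{(0)}<C_\ell$ for $\ell\notin\mathcal L_s$; $L_s=|\mathcal L_s|$. The $\epsilon$-th system has $\bm\lambda^{(\epsilon)}=(1-\epsilon)\bm\lambda^{(0)}$, everything else being independent of $\epsilon$. For $0<\epsilon<1$ the flow count process has a unique stationary distribution. **Inner product and cone.** On $\mathbb R^R$, $\langle\bm y,\bm z\rangle=\sum_r\frac{\kappa_r}{\lambda_r^{(0)}}y_rz_r$, with induced norm $\|\cdot\|$. For each link $\ell$, $\bm b^{(\ell)}\in\mathbb R^R$ has entries $b^{(\ell)}_r=\rho_r^{(0)}\mathbb 1_{\{\ell\in r\}}/\kappa_r$; $\mathcal K=\{\sum_{\ell\in\mathcal L_s}\alpha_\ell\bm b^{(\ell)}:\alpha_\ell\ge0\}$. For $\bm n\in\mathbb R^R$, $\bm n_\parallel$ is the projection (nearest point in $\|\cdot\|$) of $\bm n$ onto $\mathcal K$ and $\bm n_\perp=\bm n-\bm n_\parallel$. *)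

theory Defs
  imports "HOL-Probability.Probability" "HOL-Library.Landau_Symbols"
begin

definition routing_matrix :: "('r::finite \<Rightarrow> 'l::finite set) \<Rightarrow> real^'r^'l" where
  "routing_matrix links = (\<chi> l r. if l \<in> links r then 1 else 0)"

text \<open>
  The logarithm in the objective is extended-real valued, with \<open>log 0 = -\<infinity>\<close>. The real
  function \<^const>\<open>ln\<close> has \<open>ln 0 = 0\<close>, which would distort the maximization on the boundary of the
  feasible set. In \<^typ>\<open>ereal\<close> we have \<open>0 * (-\<infinity>) = 0\<close>, so empty routes do not contribute.
\<close>

definition ext_log :: "real \<Rightarrow> ereal" where
  "ext_log x = (if x > 0 then ereal (ln x) else -\<infinity>)"

definition pf_objective :: "real^'r::finite \<Rightarrow> nat^'r \<Rightarrow> real^'r \<Rightarrow> ereal" where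
  "pf_objective \<kappa> n x = (\<Sum>r\<in>UNIV. ereal (\<kappa> $ r * real (n $ r)) * ext_log (x $ r))"

definition pf_feasible ::
    "('r::finite \<Rightarrow> 'l::finite set) \<Rightarrow> real^'l \<Rightarrow> nat^'r \<Rightarrow> real^'r \<Rightarrow> bool" where
  "pf_feasible links C n x \<longleftrightarrow>
     (\<forall>l. (\<Sum>r | l \<in> links r. real (n $ r) * x $ r) \<le> C $ l) \<and>
     (\<forall>r. 0 \<le> x $ r) \<and> (\<forall>r. n $ r = 0 \<longrightarrow> x $ r = 0)"

definition weighted_proportionally_fair ::
    "('r::finite \<Rightarrow> 'l::finite set) \<Rightarrow> real^'l \<Rightarrow> real^'r \<Rightarrow> (nat^'r \<Rightarrow> real^'r) \<Rightarrow> bool" where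
  "weighted_proportionally_fair links C \<kappa> x \<longleftrightarrow>
     (\<forall>n. is_arg_max (pf_objective \<kappa> n) (pf_feasible links C n) (x n))"

text \<open>
  A departure \<open>n \<rightarrow> n' = n - e\<^sup>(\<^sup>r\<^sup>)\<close> is expressed as \<open>n = n' + e\<^sup>(\<^sup>r\<^sup>)\<close>, to avoid truncated
  subtraction on the natural numbers.
\<close>

definition flow_rate ::
    "real^'r::finite \<Rightarrow> real^'r \<Rightarrow> (nat^'r \<Rightarrow> real^'r) \<Rightarrow> nat^'r \<Rightarrow> nat^'r \<Rightarrow> real" where
  "flow_rate lam \<mu> x n n' =
     (\<Sum>r\<in>UNIV. (if n' = n + axis r 1 then lam $ r else 0) +
                 (if n = n' + axis r 1 then real (n $ r) * x n $ r * \<mu> $ r else 0))"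

text \<open>
  \<open>P t i\<close> is the law at time \<open>t\<close> of a continuous-time Markov chain started in \<open>i\<close>, with off-diagonal
  transition rates \<open>q\<close>. The transition function is honest, satisfies the Chapman-Kolmogorov
  equations, and its derivative at \<open>0\<close> is the conservative generator given by \<open>q\<close>; the values
  \<open>q i i\<close> are irrelevant.
\<close>

definition ctmc_transition_function ::
    "('s \<Rightarrow> 's \<Rightarrow> real) \<Rightarrow> (real \<Rightarrow> 's \<Rightarrow> 's pmf) \<Rightarrow> bool" where
  "ctmc_transition_function q P \<longleftrightarrow>
     (\<forall>i. P 0 i = return_pmf i) \<and>
     (\<forall>s\<ge>0. \<forall>t\<ge>0. \<forall>i. P (s + t) i = bind_pmf (P s i) (P t)) \<and>
     (\<forall>i j. i \<noteq> j \<longrightarrow> ((\<lambda>t. pmf (P t i) j / t) \<longlongrightarrow> q i j) (at_right 0)) \<and>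
     (\<forall>i. ((\<lambda>t. (1 - pmf (P t i) i) / t) \<longlongrightarrow> infsum (q i) (- {i})) (at_right 0))"

definition ctmc_stationary :: "('s \<Rightarrow> 's \<Rightarrow> real) \<Rightarrow> 's pmf \<Rightarrow> bool" where
  "ctmc_stationary q \<pi> \<longleftrightarrow>
     (\<exists>P. ctmc_transition_function q P \<and> (\<forall>t\<ge>0. bind_pmf \<pi> (P t) = \<pi>))"

definition w_inner :: "real^'r::finite \<Rightarrow> real^'r \<Rightarrow> real^'r \<Rightarrow> real^'r \<Rightarrow> real" where
  "w_inner \<kappa> lam0 y z = (\<Sum>r\<in>UNIV. \<kappa> $ r / lam0 $ r * y $ r * z $ r)"

definition w_norm :: "real^'r::finite \<Rightarrow> real^'r \<Rightarrow> real^'r \<Rightarrow> real" where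
  "w_norm \<kappa> lam0 y = sqrt (w_inner \<kappa> lam0 y y)"

definition cone_gen ::
    "('r::finite \<Rightarrow> 'l::finite set) \<Rightarrow> real^'r \<Rightarrow> real^'r \<Rightarrow> real^'r \<Rightarrow> 'l \<Rightarrow> real^'r" where
  "cone_gen links \<kappa> lam0 \<mu> l =
     (\<chi> r. (lam0 $ r / \<mu> $ r) * (if l \<in> links r then 1 else 0) / \<kappa> $ r)"

definition ssc_cone ::
    "('r::finite \<Rightarrow> 'l::finite set) \<Rightarrow> real^'r \<Rightarrow> real^'r \<Rightarrow> real^'r \<Rightarrow> 'l set \<Rightarrow> (real^'r) set" where
  "ssc_cone links \<kappa> lam0 \<mu> Ls =
     {(\<Sum>l\<in>Ls. \<alpha> l *\<^sub>R cone_gen links \<kappa> lam0 \<mu> l) | \<alpha>. \<forall>l\<in>Ls. (0::real) \<le> \<alpha> l}"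

definition par_part ::
    "('r::finite \<Rightarrow> 'l::finite set) \<Rightarrow> real^'r \<Rightarrow> real^'r \<Rightarrow> real^'r \<Rightarrow> 'l set \<Rightarrow> real^'r \<Rightarrow> real^'r" where
  "par_part links \<kappa> lam0 \<mu> Ls n =
     arg_min_on (\<lambda>k. w_norm \<kappa> lam0 (n - k)) (ssc_cone links \<kappa> lam0 \<mu> Ls)"

definition perp_part ::
    "('r::finite \<Rightarrow> 'l::finite set) \<Rightarrow> real^'r \<Rightarrow> real^'r \<Rightarrow> real^'r \<Rightarrow> 'l set \<Rightarrow> real^'r \<Rightarrow> real^'r" where
  "perp_part links \<kappa> lam0 \<mu> Ls n = n - par_part links \<kappa> lam0 \<mu> Ls n"

definition real_state :: "nat^'r::finite \<Rightarrow> real^'r" where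
  "real_state n = (\<chi> r. real (n $ r))"

end

theory Submission
  imports Defs
begin

text \<open>
  Write \<open>\<gamma>\<^sub>r = n\<^sub>r x\<^sub>r(n)\<close>, let \<open>p\<^sub>\<ell> \<ge> 0\<close> be KKT multipliers of the allocation in state \<open>n\<close>, and put
  \<open>P\<^sub>r = \<Sum>\<^sub>\<ell>\<^sub>\<in>\<^sub>r p\<^sub>\<ell>\<close>, so that \<open>\<gamma>\<^sub>r P\<^sub>r = \<kappa>\<^sub>r n\<^sub>r\<close>. Then
  \<open>\<langle>n, \<lambda> - \<mu>\<gamma>\<rangle> = - \<Sum>\<^sub>r P\<^sub>r (\<gamma>\<^sub>r - \<rho>\<^sub>r)\<^sup>2 / \<rho>\<^sub>r - \<Sum>\<^sub>\<ell> p\<^sub>\<ell> (C\<^sub>\<ell> - \<Sum>\<^sub>r\<^sub>\<ni>\<^sub>\<ell> \<rho>\<^sub>r)\<close> at the critical arrival rates \<open>\<lambda>\<close>. Comparing \<open>n\<close>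
  with the cone element that has coefficients \<open>p\<^sub>\<ell>\<close> shows that this is at most
  \<open>- c \<parallel>n\<^sub>\<bottom>\<parallel>\<^sup>2 / \<parallel>n\<parallel>\<close>; the same bound holds for \<open>\<langle>n\<^sub>\<bottom>, \<lambda> - \<mu>\<gamma>\<rangle>\<close>, because \<open>\<langle>b, \<lambda> - \<mu>\<gamma>\<rangle> \<ge> 0\<close> for all
  \<open>b\<close> in the cone.

  With powers of \<open>\<parallel>n\<parallel>\<^sup>2 + 1/\<epsilon>\<^sup>2\<close> as Lyapunov functions, the additional drift \<open>- \<epsilon> \<Sum>\<^sub>r \<kappa>\<^sub>r n\<^sub>r\<close> gives
  a mean of order \<open>1/\<epsilon>\<^sup>k\<close> for \<open>\<parallel>n\<parallel>\<^sup>k\<close>. With powers of \<open>1 + \<parallel>n\<^sub>\<bottom>\<parallel>\<^sup>2\<close> the drift contains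
  \<open>- c \<parallel>n\<^sub>\<bottom>\<parallel>\<^sup>2\<^sup>k\<^sup>+\<^sup>2 / \<parallel>n\<parallel>\<close>, which dominates \<open>\<parallel>n\<^sub>\<bottom>\<parallel>\<^sup>2\<^sup>k\<close> up to \<open>\<parallel>n\<parallel>\<^sup>k\<close>; hence
  \<open>\<parallel>n\<^sub>\<bottom>\<parallel>\<^sup>2\<^sup>k\<close> has a mean of order \<open>1/\<epsilon>\<^sup>k\<close>.
\<close>

section \<open>Drift and stationarity of continuous-time Markov chains\<close>

text \<open>The generator applied to \<open>f\<close>. The sum runs over the support of row
  \<open>i\<close>; for an infinite support it would default to 0, so the general lemmas below
  assume finiteness.\<close>

definition ctmc_drift :: "('s \<Rightarrow> 's \<Rightarrow> real) \<Rightarrow> ('s \<Rightarrow> real) \<Rightarrow> 's \<Rightarrow> real" where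
  "ctmc_drift q f i = (\<Sum>j | j \<noteq> i \<and> q i j \<noteq> 0. q i j * (f j - f i))"

text \<open>The detour through nonnegative integrals lets the integral over \<open>bind_pmf\<close>
  be iterated without side conditions; the bounds on \<open>f\<close> allow the return to
  expectations.\<close>

lemma expectation_bind_pmf:
  fixes f :: "'a \<Rightarrow> real"
  assumes "\<And>x. 0 \<le> f x" "\<And>x. f x \<le> B"
  shows "measure_pmf.expectation (bind_pmf p P) f =
         measure_pmf.expectation p (\<lambda>i. measure_pmf.expectation (P i) f)"
proof -
  have int: "integrable (measure_pmf r) f" for r :: "'a pmf"
    using assms by (intro measure_pmf.integrable_const_bound[where B=B]) auto
  have E_nonneg: "0 \<le> measure_pmf.expectation r f" for r :: "'a pmf"
    using assms by simp
  have E_le: "measure_pmf.expectation r f \<le> B" for r :: "'a pmf"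
    using measure_pmf.integral_le_const[OF int] assms by simp
  have "ennreal (measure_pmf.expectation (bind_pmf p P) f) = (\<integral>\<^sup>+x. f x \<partial>bind_pmf p P)"
    using assms int by (intro nn_integral_eq_integral[symmetric]) auto
  also have "\<dots> = (\<integral>\<^sup>+i. ennreal (measure_pmf.expectation (P i) f) \<partial>p)"
    using assms int by (simp add: nn_integral_eq_integral)
  also have "\<dots> = ennreal (measure_pmf.expectation p (\<lambda>i. measure_pmf.expectation (P i) f))"
    using E_nonneg E_le
    by (intro nn_integral_eq_integral measure_pmf.integrable_const_bound[where B=B]) auto
  finally show ?thesis
    using E_nonneg by (simp add: ennreal_inj)
qed

text \<open>Only the path through the intermediate state \<open>k\<close> is kept. With all states
  equal this gives super-multiplicativity of the holding probability.\<close>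

lemma pmf_bind_ge_mult: "pmf p k * pmf (Q k) j \<le> pmf (bind_pmf p Q) j"
proof -
  have "pmf p k * pmf (Q k) j = measure_pmf.expectation p (\<lambda>i. indicator {k} i * pmf (Q k) j)"
    by (simp add: measure_pmf_single)
  also have "\<dots> \<le> measure_pmf.expectation p (\<lambda>i. pmf (Q i) j)"
    by (intro integral_mono measure_pmf.integrable_const_bound[where B=1])
       (auto simp: indicator_def pmf_le_1)
  finally show ?thesis by (simp add: pmf_bind)
qed

lemma ctmc_holding_power:
  assumes P: "ctmc_transition_function q P" and t: "0 \<le> t"
  shows "pmf (P t i) i ^ n \<le> pmf (P (real n * t) i) i"
proof (induction n)
  case 0
  have "P 0 i = return_pmf i" using P by (simp add: ctmc_transition_function_def)
  then show ?case by simp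
next
  case (Suc n)
  have "pmf (P t i) i ^ Suc n \<le> pmf (P (real n * t) i) i * pmf (P t i) i"
    using Suc by (simp add: mult.commute mult_left_mono)
  also have "\<dots> \<le> pmf (bind_pmf (P (real n * t) i) (P t)) i"
    by (rule pmf_bind_ge_mult)
  also have "bind_pmf (P (real n * t) i) (P t) = P (real n * t + t) i"
    using P t unfolding ctmc_transition_function_def by (metis mult_nonneg_nonneg of_nat_0_le_iff)
  finally show ?case by (simp add: algebra_simps)
qed

text \<open>Super-multiplicativity of \<open>t \<mapsto> p\<^sub>i\<^sub>i(t)\<close> and Bernoulli's inequality make the derivative at
  \<open>0\<close> a bound for all times.\<close>

lemma ctmc_exit_probability_le:
  assumes P: "ctmc_transition_function q P" and t: "0 < t"
  shows "1 - pmf (P t i) i \<le> infsum (q i) (- {i}) * t"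
proof (rule field_le_epsilon)
  fix e :: real assume e: "0 < e"
  define Q where "Q = infsum (q i) (- {i})"
  have "((\<lambda>t. (1 - pmf (P t i) i) / t) \<longlongrightarrow> Q) (at_right 0)"
    using P unfolding ctmc_transition_function_def Q_def by blast
  moreover have "filterlim (\<lambda>n. t / real (Suc n)) (at_right 0) sequentially"
    using t by real_asymp
  ultimately have "(\<lambda>n. (1 - pmf (P (t / real (Suc n)) i) i) / (t / real (Suc n))) \<longlonglongrightarrow> Q"
    by (rule filterlim_compose)
  \<comment> \<open>The time \<open>t\<close> is cut into \<open>Suc n\<close> equal pieces, short
    enough that the difference quotient exceeds \<open>Q\<close> by less than \<open>e / t\<close>;
    over the whole time this error amounts to \<open>e\<close>.\<close>
  then have "\<forall>\<^sub>F n in sequentially. (1 - pmf (P (t / real (Suc n)) i) i) / (t / real (Suc n)) < Q + e / t"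
    by (rule order_tendstoD) (use e t in simp)
  then obtain n where n: "(1 - pmf (P (t / real (Suc n)) i) i) / (t / real (Suc n)) < Q + e / t"
    by (auto simp: eventually_sequentially)
  define p where "p = pmf (P (t / real (Suc n)) i) i"
  have p: "0 \<le> p" "p \<le> 1" by (auto simp: p_def pmf_le_1)
  have "real (Suc n) * (1 - p) = (1 - p) / (t / real (Suc n)) * t"
    using t by simp
  also have "\<dots> < (Q + e / t) * t"
    using n t unfolding p_def by (intro mult_strict_right_mono)
  also have "\<dots> = Q * t + e"
    using t by (simp add: distrib_right)
  finally have "real (Suc n) * (1 - p) < Q * t + e" .
  moreover have "1 - real (Suc n) * (1 - p) \<le> p ^ Suc n"
    using Bernoulli_inequality[of "p - 1" "Suc n"] p by (simp add: algebra_simps)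
  moreover have "p ^ Suc n \<le> pmf (P (real (Suc n) * (t / real (Suc n))) i) i"
    unfolding p_def using t by (intro ctmc_holding_power[OF P]) auto
  moreover have "real (Suc n) * (t / real (Suc n)) = t"
    using t by (simp del: of_nat_Suc)
  ultimately have "1 - (Q * t + e) \<le> pmf (P t i) i"
    by simp
  then show "1 - pmf (P t i) i \<le> infsum (q i) (- {i}) * t + e"
    unfolding Q_def by simp
qed

lemma infsum_finite_rates:
  assumes "finite {j. j \<noteq> i \<and> q i j \<noteq> 0}"
  shows "infsum (q i) (- {i}) = (\<Sum>j | j \<noteq> i \<and> q i j \<noteq> 0. (q i j :: real))"
proof -
  have "infsum (q i) (- {i}) = infsum (q i) {j. j \<noteq> i \<and> q i j \<noteq> 0}"
    by (rule infsum_cong_neutral) auto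
  then show ?thesis using assms by simp
qed

text \<open>Derivatives of single transition probabilities only control finitely many targets. The
  rest is controlled by conservativity: the exit probability has the total rate into
  \<open>J\<close> as derivative, so the mass outside \<open>insert i J\<close> is o(t), and
  \<open>f\<close> is bounded.\<close>

lemma ctmc_drift_tendsto:
  fixes f :: "'s \<Rightarrow> real"
  assumes P: "ctmc_transition_function q P"
    and fin: "finite {j. j \<noteq> i \<and> q i j \<noteq> 0}"
    and f: "\<And>x. 0 \<le> f x" "\<And>x. f x \<le> B"
  shows "((\<lambda>t. (measure_pmf.expectation (P t i) f - f i) / t) \<longlongrightarrow> ctmc_drift q f i) (at_right 0)"
proof -
  define J where "J = {j. j \<noteq> i \<and> q i j \<noteq> 0}"
  have J: "finite J" "i \<notin> J" using fin by (auto simp: J_def)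
  have lim: "((\<lambda>t. pmf (P t i) j / t) \<longlongrightarrow> q i j) (at_right 0)" if "j \<in> J" for j
    using P that unfolding ctmc_transition_function_def J_def by auto
  have lim0: "((\<lambda>t. (1 - pmf (P t i) i) / t) \<longlongrightarrow> (\<Sum>j\<in>J. q i j)) (at_right 0)"
    using P unfolding J_def infsum_finite_rates[of i q, OF fin, symmetric]
      ctmc_transition_function_def by blast
  define S where "S t = (\<Sum>j\<in>J. pmf (P t i) j / t * (f j - f i))" for t
  \<comment> \<open>\<open>R t\<close> is the probability of being outside \<open>insert i J\<close>
    at time \<open>t\<close>, divided by \<open>t\<close>.\<close>
  define R where "R t = (1 - pmf (P t i) i) / t - (\<Sum>j\<in>J. pmf (P t i) j / t)" for t
  have "(S \<longlongrightarrow> ctmc_drift q f i) (at_right 0)"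
    unfolding S_def ctmc_drift_def J_def[symmetric] by (intro tendsto_intros lim)
  moreover have "((\<lambda>t. (measure_pmf.expectation (P t i) f - f i) / t - S t) \<longlongrightarrow> 0) (at_right 0)"
  proof (rule tendsto_0_le[where K = B])
    have "(R \<longlongrightarrow> (\<Sum>j\<in>J. q i j) - (\<Sum>j\<in>J. q i j)) (at_right 0)"
      unfolding R_def by (intro tendsto_intros lim lim0)
    then show "(R \<longlongrightarrow> 0) (at_right 0)" by simp
    have "norm ((measure_pmf.expectation (P t i) f - f i) / t - S t) \<le> norm (R t) * B"
      if t: "t > 0" for t
    proof -
      let ?p = "P t i"
      have int: "integrable (measure_pmf ?p) g" if "\<And>x. \<bar>g x\<bar> \<le> c" for g :: "'s \<Rightarrow> real" and c
        using that by (intro measure_pmf.integrable_const_bound[where B=c]) auto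
      have fB: "\<bar>f j - f i\<bar> \<le> B" for j using f[of j] f[of i] by linarith
      have intJ: "integrable (measure_pmf ?p) (\<lambda>j. indicator J j * (f j - f i))"
        using fB f(1)[of i] f(2)[of i] by (intro int[where c=B]) (auto simp: indicator_def)
      have intf: "integrable (measure_pmf ?p) (\<lambda>j. f j - f i)"
        using fB by (intro int[where c=B])
      have EJ: "measure_pmf.expectation ?p (\<lambda>j. indicator J j * (f j - f i)) =
          (\<Sum>j\<in>J. pmf ?p j * (f j - f i))"
        using J by (subst integral_measure_pmf_real[of J])
          (auto simp: indicator_def mult.commute intro!: sum.cong split: if_splits)
      have Ef: "measure_pmf.expectation ?p (\<lambda>j. f j - f i) = measure_pmf.expectation ?p f - f i"
        using f by (subst Bochner_Integration.integral_diff) (auto intro!: int[where c=B])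
      have "(measure_pmf.expectation ?p f - f i) - (\<Sum>j\<in>J. pmf ?p j * (f j - f i)) =
          measure_pmf.expectation ?p (\<lambda>j. (f j - f i) - indicator J j * (f j - f i))"
        using intJ intf by (simp add: EJ Ef)
      also have "\<bar>\<dots>\<bar> \<le> measure_pmf.expectation ?p (\<lambda>j. B * indicator (- insert i J) j)"
        using fB f(1)[of i] f(2)[of i]
        by (intro order_trans[OF integral_abs_bound] integral_mono integrable_abs
            Bochner_Integration.integrable_diff intJ intf int[where c="\<bar>B\<bar>"])
           (auto simp: indicator_def)
      also have "\<dots> = B * measure_pmf.prob ?p (- insert i J)"
        by simp
      also have "measure_pmf.prob ?p (- insert i J) = 1 - pmf ?p i - (\<Sum>j\<in>J. pmf ?p j)"
        using J measure_pmf.prob_compl[of "insert i J" ?p]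
        by (simp add: Compl_eq_Diff_UNIV measure_measure_pmf_finite)
      finally have *: "\<bar>(measure_pmf.expectation ?p f - f i) - (\<Sum>j\<in>J. pmf ?p j * (f j - f i))\<bar>
          \<le> B * (1 - pmf ?p i - (\<Sum>j\<in>J. pmf ?p j))" .
      have "(measure_pmf.expectation ?p f - f i) / t - S t =
          ((measure_pmf.expectation ?p f - f i) - (\<Sum>j\<in>J. pmf ?p j * (f j - f i))) / t"
        by (simp add: S_def diff_divide_distrib sum_divide_distrib)
      moreover have "R t = (1 - pmf ?p i - (\<Sum>j\<in>J. pmf ?p j)) / t"
        by (simp add: R_def diff_divide_distrib sum_divide_distrib)
      ultimately have "\<bar>(measure_pmf.expectation ?p f - f i) / t - S t\<bar> \<le> B * R t"
        using * t by (simp add: divide_right_mono)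
      also have "\<dots> \<le> \<bar>R t\<bar> * B" 
        using f(1)[of i] f(2)[of i] by (simp add: mult.commute mult_left_mono)
      finally show ?thesis by simp
    qed
    then show "\<forall>\<^sub>F t in at_right 0.
        norm ((measure_pmf.expectation (P t i) f - f i) / t - S t) \<le> norm (R t) * B"
      by (auto simp: eventually_at_right_field intro: exI[of _ 1])
  qed
  ultimately show ?thesis
    using tendsto_add[of S "ctmc_drift q f i" "at_right 0"
        "\<lambda>t. (measure_pmf.expectation (P t i) f - f i) / t - S t" 0] by simp
qed

text \<open>By invariance the difference quotients of \<open>f\<close> along the semigroup have mean
  0. The exit probability estimate bounds them by \<open>B * \<Lambda>\<close> uniformly in state
  and time, so dominated convergence carries the mean over to the drift.\<close>

lemma stationary_drift_bounded:
  fixes f :: "'s \<Rightarrow> real"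
  assumes st: "ctmc_stationary q \<pi>"
    and fin: "\<And>i. finite {j. j \<noteq> i \<and> q i j \<noteq> 0}"
    and \<Lambda>: "\<And>i. (\<Sum>j | j \<noteq> i \<and> q i j \<noteq> 0. q i j) \<le> \<Lambda>"
    and f: "\<And>x. 0 \<le> f x" "\<And>x. f x \<le> B"
  shows "integrable (measure_pmf \<pi>) (ctmc_drift q f)"
    and "measure_pmf.expectation \<pi> (ctmc_drift q f) = 0"
proof -
  obtain P where P: "ctmc_transition_function q P"
    and inv: "\<And>t. 0 \<le> t \<Longrightarrow> bind_pmf \<pi> (P t) = \<pi>"
    using st unfolding ctmc_stationary_def by blast
  \<comment> \<open>A sequence of times decreasing to 0, since dominated convergence is applied to
    sequences.\<close>
  define T where "T n = 1 / real (Suc n)" for n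
  have T: "T n > 0" for n by (simp add: T_def)
  have T_lim: "filterlim T (at_right 0) sequentially"
    unfolding T_def by real_asymp
  define s where "s n i = (measure_pmf.expectation (P (T n) i) f - f i) / T n" for n i
  have s_lim: "(\<lambda>n. s n i) \<longlonglongrightarrow> ctmc_drift q f i" for i
    unfolding s_def by (rule filterlim_compose[OF ctmc_drift_tendsto[OF P fin f] T_lim])
  have int: "integrable (measure_pmf p) g" if "\<And>x. \<bar>g x\<bar> \<le> c" for p and g :: "'s \<Rightarrow> real" and c
    using that by (intro measure_pmf.integrable_const_bound[where B=c]) auto
  have B: "0 \<le> B" using f order_trans by blast
  have E_bound: "\<bar>measure_pmf.expectation p f\<bar> \<le> B" for p
  proof -
    have "measure_pmf.expectation p f \<le> B" "0 \<le> measure_pmf.expectation p f"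
      using f by (auto intro!: measure_pmf.integral_le_const int[where c=B])
    then show ?thesis by simp
  qed
  have s_bound: "norm (s n i) \<le> B * \<Lambda>" for n i
  proof -
    let ?p = "P (T n) i"
    have fB: "\<bar>f j - f i\<bar> \<le> B" for j using f[of j] f[of i] by linarith
    have "measure_pmf.expectation ?p f - f i = measure_pmf.expectation ?p (\<lambda>j. f j - f i)"
      using f by (subst Bochner_Integration.integral_diff) (auto intro!: int[where c=B])
    also have "\<bar>\<dots>\<bar> \<le> measure_pmf.expectation ?p (\<lambda>j. B * indicator (- {i}) j)"
      using fB B
      by (intro order_trans[OF integral_abs_bound] integral_mono integrable_abs int[where c="B"])
         (auto simp: indicator_def)
    also have "\<dots> = B * (1 - pmf ?p i)"
      using measure_pmf.prob_compl[of "{i}" ?p]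
      by (simp add: Compl_eq_Diff_UNIV measure_pmf_single)
    also have "\<dots> \<le> B * (\<Lambda> * T n)"
    proof (rule mult_left_mono[OF _ B])
      have "1 - pmf ?p i \<le> infsum (q i) (- {i}) * T n"
        by (rule ctmc_exit_probability_le[OF P T])
      also have "\<dots> \<le> \<Lambda> * T n"
        using \<Lambda>[of i] T[of n] infsum_finite_rates[of i q, OF fin] by (intro mult_right_mono) auto
      finally show "1 - pmf ?p i \<le> \<Lambda> * T n" .
    qed
    finally show ?thesis using T[of n] by (simp add: s_def field_simps)
  qed
  have Es: "measure_pmf.expectation \<pi> (s n) = 0" for n
  proof -
    have "measure_pmf.expectation \<pi> (s n) = (measure_pmf.expectation \<pi>
        (\<lambda>i. measure_pmf.expectation (P (T n) i) f) - measure_pmf.expectation \<pi> f) / T n"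
      unfolding s_def using f E_bound
      by (subst Bochner_Integration.integral_divide_zero, subst Bochner_Integration.integral_diff)
         (auto intro!: int[where c=B])
    also have "\<dots> = 0"
      using expectation_bind_pmf[OF f, of \<pi> "P (T n)"] inv[of "T n"] T[of n] by simp
    finally show ?thesis .
  qed
  note dct = s_lim s_bound
  show "integrable (measure_pmf \<pi>) (ctmc_drift q f)"
    by (rule integrable_dominated_convergence[where s=s and w="\<lambda>_. B * \<Lambda>"])
       (use dct in auto)
  have "(\<lambda>n. measure_pmf.expectation \<pi> (s n)) \<longlonglongrightarrow> measure_pmf.expectation \<pi> (ctmc_drift q f)"
    by (rule integral_dominated_convergence[where w="\<lambda>_. B * \<Lambda>"])
       (use dct in auto)
  then show "measure_pmf.expectation \<pi> (ctmc_drift q f) = 0"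
    unfolding Es using LIMSEQ_unique tendsto_const by blast
qed

text \<open>Truncation at level \<open>N\<close> keeps the drift inequality on \<open>{f < N}\<close> and makes the drift
  nonpositive elsewhere, so no integrability of \<open>f\<close> is required.\<close>

theorem stationary_moment_bound:
  fixes f g h :: "'s \<Rightarrow> real"
  assumes st: "ctmc_stationary q \<pi>"
    and fin: "\<And>i. finite {j. j \<noteq> i \<and> q i j \<noteq> 0}"
    and q: "\<And>i j. 0 \<le> q i j"
    and \<Lambda>: "\<And>i. (\<Sum>j | j \<noteq> i \<and> q i j \<noteq> 0. q i j) \<le> \<Lambda>"
    and f: "\<And>i. 0 \<le> f i" and g: "\<And>i. 0 \<le> g i" and h: "\<And>i. 0 \<le> h i"
    and int_h: "integrable (measure_pmf \<pi>) h"
    and drift: "\<And>i. ctmc_drift q f i + g i \<le> h i"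
  shows "integrable (measure_pmf \<pi>) g"
    and "measure_pmf.expectation \<pi> g \<le> measure_pmf.expectation \<pi> h"
proof -
  define F where "F N i = min (f i) (real N)" for N i
  define G where "G N i = (if f i < real N then g i else 0)" for N i
  have F: "0 \<le> F N i" "F N i \<le> real N" for N i using f by (auto simp: F_def)
  have DF: "G N i \<le> h i - ctmc_drift q (F N) i" for N i
  proof (cases "f i < real N")
    case True
    have "ctmc_drift q (F N) i \<le> ctmc_drift q f i"
      unfolding ctmc_drift_def using q True by (intro sum_mono mult_left_mono) (auto simp: F_def)
    with drift[of i] True show ?thesis by (simp add: G_def)
  next
    case False
    have "ctmc_drift q (F N) i \<le> 0"
      unfolding ctmc_drift_def using q False
      by (intro sum_nonpos mult_nonneg_nonpos) (auto simp: F_def)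
    with h[of i] False show ?thesis by (simp add: G_def)
  qed
  note D = stationary_drift_bounded[OF st fin \<Lambda>, of "F N" "real N" for N, OF F]
  have G0: "0 \<le> G N i" for N i using g by (simp add: G_def)
  have int_G: "integrable (measure_pmf \<pi>) (G N)" for N
    by (rule Bochner_Integration.integrable_bound[OF Bochner_Integration.integrable_diff[OF int_h D(1)[of N]]])
       (auto intro!: AE_I2 order_trans[OF DF] simp: abs_of_nonneg[OF G0])
  have EG: "measure_pmf.expectation \<pi> (G N) \<le> measure_pmf.expectation \<pi> h" for N
  proof -
    have "measure_pmf.expectation \<pi> (G N) \<le>
        measure_pmf.expectation \<pi> (\<lambda>i. h i - ctmc_drift q (F N) i)"
      by (intro integral_mono int_G Bochner_Integration.integrable_diff int_h D(1) DF)
    also have "\<dots> = measure_pmf.expectation \<pi> h"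
      using int_h D[of N] by simp
    finally show ?thesis .
  qed
  have mono: "mono (\<lambda>N. G N i)" for i using g by (auto simp: G_def mono_def)
  have lim: "(\<lambda>N. G N i) \<longlonglongrightarrow> g i" for i
  proof (rule tendsto_eventually)
    obtain N0 :: nat where "f i < real N0" using reals_Archimedean2 by blast
    then show "\<forall>\<^sub>F N in sequentially. G N i = g i"
      by (auto simp: G_def eventually_sequentially intro!: exI[of _ N0])
  qed
  \<comment> \<open>The means of \<open>G N\<close> increase and stay below the mean of
    \<open>h\<close>; monotone convergence then gives integrability of \<open>g\<close> together
    with the bound.\<close>
  have "incseq (\<lambda>N. measure_pmf.expectation \<pi> (G N))"
    using mono by (auto simp: incseq_def mono_def intro!: integral_mono int_G)
  then obtain L where L: "(\<lambda>N. measure_pmf.expectation \<pi> (G N)) \<longlonglongrightarrow> L"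
    using incseq_convergent EG by blast
  have meas: "(\<lambda>i. g i) \<in> borel_measurable (measure_pmf \<pi>)" by simp
  show "integrable (measure_pmf \<pi>) g"
    by (rule integrable_monotone_convergence[OF int_G _ _ L meas]) (use mono lim in auto)
  have "measure_pmf.expectation \<pi> g = L"
    by (rule integral_monotone_convergence[OF int_G _ _ L meas]) (use mono lim in auto)
  then show "measure_pmf.expectation \<pi> g \<le> measure_pmf.expectation \<pi> h"
    using LIMSEQ_le_const2[OF L] EG by blast
qed

section \<open>Power inequalities and finitely generated cones\<close>

text \<open>A first-order expansion whose error is of order \<open>x ^ k\<close>: increments of a
  squared norm \<open>x\<close> are of order \<open>sqrt x\<close>, so \<open>d\<^sup>2\<close> is
  of order \<open>x\<close>. The constant depends on \<open>D\<close> and \<open>k\<close>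
  only.\<close>

lemma power_Suc_add_le:
  fixes D :: real
  assumes "0 \<le> D"
  shows "\<exists>K\<ge>0. \<forall>x d. 1 \<le> x \<longrightarrow> \<bar>d\<bar> \<le> D * sqrt x \<longrightarrow> 0 \<le> x + d \<longrightarrow>
    (x + d) ^ Suc k \<le> x ^ Suc k + real (Suc k) * x ^ k * d + K * x ^ k"
proof (induction k)
  case 0
  show ?case by (intro exI[of _ 0]) auto
next
  case (Suc k)
  then obtain K where K: "0 \<le> K" and IH: "\<And>x d. \<lbrakk>1 \<le> x; \<bar>d\<bar> \<le> D * sqrt x; 0 \<le> x + d\<rbrakk> \<Longrightarrow>
      (x + d) ^ Suc k \<le> x ^ Suc k + real (Suc k) * x ^ k * d + K * x ^ k"
    by blast
  \<comment> \<open>Multiplying the induction hypothesis by \<open>x + d\<close> leaves three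
    errors: the one with \<open>d\<^sup>2\<close>, bounded by \<open>D\<^sup>2 * x\<close>, and
    those with \<open>K * x\<close> and \<open>K * d\<close>, where \<open>d\<close> is at most
    \<open>D * x\<close>.\<close>
  define K' where "K' = real (Suc k) * D\<^sup>2 + K + K * D"
  show ?case
  proof (intro exI[of _ K'] conjI allI impI)
    show "0 \<le> K'" using K assms by (simp add: K'_def)
    fix x d :: real assume x: "1 \<le> x" and d: "\<bar>d\<bar> \<le> D * sqrt x" and nn: "0 \<le> x + d"
    have "d\<^sup>2 \<le> (D * sqrt x)\<^sup>2" using d assms x by (simp add: abs_le_square_iff[symmetric])
    then have d2: "d\<^sup>2 \<le> D\<^sup>2 * x" using x by (simp add: power_mult_distrib)
    have "sqrt x \<le> x" using x by (intro real_le_lsqrt) (auto simp: power2_eq_square)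
    then have d1: "d \<le> D * x" using d assms by (meson abs_le_D1 mult_left_mono order_trans)
    have "(x + d) ^ Suc (Suc k) \<le> (x + d) * (x ^ Suc k + real (Suc k) * x ^ k * d + K * x ^ k)"
      using mult_left_mono[OF IH[OF x d nn] nn] by simp
    also have "\<dots> = x ^ Suc (Suc k) + real (Suc (Suc k)) * x ^ Suc k * d
        + (real (Suc k) * d\<^sup>2 + K * x + K * d) * x ^ k"
      by (simp add: algebra_simps power2_eq_square)
    also have "\<dots> \<le> x ^ Suc (Suc k) + real (Suc (Suc k)) * x ^ Suc k * d
        + (real (Suc k) * (D\<^sup>2 * x) + K * x + K * (D * x)) * x ^ k"
      using d1 d2 K x by (intro add_left_mono mult_right_mono add_mono mult_left_mono) auto
    also have "\<dots> = x ^ Suc (Suc k) + real (Suc (Suc k)) * x ^ Suc k * d + K' * x ^ Suc k"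
      by (simp add: K'_def algebra_simps)
    finally show "(x + d) ^ Suc (Suc k) \<le>
      x ^ Suc (Suc k) + real (Suc (Suc k)) * x ^ Suc k * d + K' * x ^ Suc k" .
  qed
qed

text \<open>Case split at \<open>X = B * Y / a\<close>: above it the higher power dominates, below
  it the lower power is bounded by its value there. In the drift estimates this absorbs a positive
  term into part of the negative one.\<close>

lemma absorb_power:
  fixes a B X Y :: real
  assumes "0 < a" "0 \<le> B" "0 < Y" "0 \<le> X"
  shows "B * X ^ k \<le> a * X ^ Suc k / Y + B * (B * Y / a) ^ k"
proof (cases "B \<le> a * X / Y")
  case True
  then have "B * X ^ k \<le> (a * X / Y) * X ^ k" using assms by (intro mult_right_mono) auto
  moreover have "0 \<le> B * (B * Y / a) ^ k" using assms by simp
  ultimately show ?thesis by simp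
next
  case False
  then have "X \<le> B * Y / a" using assms by (simp add: field_simps)
  then have "B * X ^ k \<le> B * (B * Y / a) ^ k" using assms by (intro mult_left_mono power_mono) auto
  moreover have "0 \<le> a * X ^ Suc k / Y" using assms by simp
  ultimately show ?thesis by linarith
qed

lemma finite_positive_lower_bound:
  fixes f :: "'a \<Rightarrow> real"
  assumes "finite A" "\<And>a. a \<in> A \<Longrightarrow> 0 < f a"
  obtains d where "0 < d" "\<And>a. a \<in> A \<Longrightarrow> d \<le> f a"
proof
  \<comment> \<open>The inserted 1 covers an empty \<open>A\<close>, such as the set of noncritical
    links when all links are critical.\<close>
  show "0 < Min (insert 1 (f ` A))" using assms by auto
  show "Min (insert 1 (f ` A)) \<le> f a" if "a \<in> A" for a using assms(1) that by (intro Min_le) auto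
qed

text \<open>Connects the coefficient description used in \<open>ssc_cone\<close> with
  \<open>convex_cone hull\<close>, for which finite generation gives closedness.\<close>

lemma convex_cone_hull_finite_image:
  fixes v :: "'i \<Rightarrow> 'a::real_vector"
  assumes "finite L"
  shows "convex_cone hull (v ` L) = {\<Sum>l\<in>L. \<alpha> l *\<^sub>R v l | \<alpha>. \<forall>l\<in>L. (0::real) \<le> \<alpha> l}" (is "_ = ?K")
proof (rule hull_unique)
  show "v ` L \<subseteq> ?K"
  proof
    fix y assume "y \<in> v ` L"
    then obtain i where i: "i \<in> L" "y = v i" by blast
    have "(\<Sum>l\<in>L. (if l = i then 1 else 0) *\<^sub>R v l) = (\<Sum>l\<in>L. if l = i then v l else 0)"
      by (intro sum.cong) auto
    then have "y = (\<Sum>l\<in>L. (if l = i then 1 else 0) *\<^sub>R v l)"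
      using i assms by simp
    then show "y \<in> ?K" by (auto intro!: exI[of _ "\<lambda>l. if l = i then 1 else 0"])
  qed
  show "convex_cone ?K"
    unfolding convex_cone_iff
  proof (intro conjI ballI allI impI)
    show "0 \<in> ?K" by (auto intro!: exI[of _ "\<lambda>_. 0"])
  next
    fix y z assume "y \<in> ?K" "z \<in> ?K"
    then obtain \<alpha> \<beta> where "\<forall>l\<in>L. 0 \<le> \<alpha> l" "y = (\<Sum>l\<in>L. \<alpha> l *\<^sub>R v l)"
      "\<forall>l\<in>L. 0 \<le> \<beta> l" "z = (\<Sum>l\<in>L. \<beta> l *\<^sub>R v l)" by blast
    then show "y + z \<in> ?K"
      by (auto simp: scaleR_add_left sum.distrib intro!: exI[of _ "\<lambda>l. \<alpha> l + \<beta> l"])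
  next
    fix y c assume "y \<in> ?K" and c: "0 \<le> (c::real)"
    then obtain \<alpha> where "\<forall>l\<in>L. 0 \<le> \<alpha> l" "y = (\<Sum>l\<in>L. \<alpha> l *\<^sub>R v l)" by blast
    with c show "c *\<^sub>R y \<in> ?K"
      by (auto simp: scaleR_sum_right intro!: exI[of _ "\<lambda>l. c * \<alpha> l"])
  qed
next
  fix t assume t: "v ` L \<subseteq> t" "convex_cone t"
  show "?K \<subseteq> t"
  proof clarify
    fix \<alpha> :: "'i \<Rightarrow> real" assume \<alpha>: "\<forall>l\<in>L. 0 \<le> \<alpha> l"
    have "(\<Sum>l\<in>A. \<alpha> l *\<^sub>R v l) \<in> t" if "A \<subseteq> L" for A
      using finite_subset[OF that assms] that
    proof (induction A)
      case empty then show ?case using t convex_cone_contains_0 by simp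
    next
      case (insert i A)
      then show ?case using t \<alpha> by (auto simp: convex_cone_add convex_cone_scaleR)
    qed
    then show "(\<Sum>l\<in>L. \<alpha> l *\<^sub>R v l) \<in> t" by blast
  qed
qed

text \<open>Otherwise a hyperplane strictly separates \<open>v\<close> from the closed cone
  generated by the \<open>a l\<close>, and its reversed normal contradicts
  \<open>dual\<close>.\<close>

lemma farkas:
  fixes v :: "'a::euclidean_space"
  assumes L: "finite L"
    and dual: "\<And>d. \<forall>l\<in>L. d \<bullet> a l \<le> 0 \<Longrightarrow> d \<bullet> v \<le> 0"
  obtains \<alpha> where "\<forall>l\<in>L. (0::real) \<le> \<alpha> l" "v = (\<Sum>l\<in>L. \<alpha> l *\<^sub>R a l)"
proof -
  define K where "K = convex_cone hull (a ` L)"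
  have "v \<in> K"
  proof (rule ccontr)
    assume "v \<notin> K"
    moreover have "convex K" "closed K"
      using L by (auto simp: K_def convex_convex_cone_hull closed_convex_cone_hull)
    ultimately obtain d b where b: "d \<bullet> v < b" "\<And>y. y \<in> K \<Longrightarrow> b < d \<bullet> y"
      using separating_hyperplane_closed_point[of K v] by auto
    have "b < 0" using b(2)[of 0] by (simp add: K_def convex_cone_hull_contains_0)
    have "0 \<le> d \<bullet> a l" if l: "l \<in> L" for l
    proof (rule ccontr)
      assume neg: "\<not> 0 \<le> d \<bullet> a l"
      \<comment> \<open>Numerator and denominator are both negative, so this multiple of
        \<open>a l\<close> lies in the cone; its inner product with \<open>d\<close> is exactly
        \<open>b\<close>, which strict separation forbids.\<close>
      have "(b / (d \<bullet> a l)) *\<^sub>R a l \<in> K"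
        unfolding K_def using l \<open>b < 0\<close> neg
        by (intro convex_cone_hull_mul hull_inc) (auto simp: divide_nonpos_nonpos)
      from b(2)[OF this] neg show False by simp
    qed
    then have "(- d) \<bullet> v \<le> 0" by (intro dual) auto
    with b(1) \<open>b < 0\<close> show False by simp
  qed
  then show ?thesis
    using that unfolding K_def convex_cone_hull_finite_image[OF L] by blast
qed

section \<open>Weighted proportional fairness\<close>

lemma w_inner_add_left: "w_inner \<kappa> lam0 (y + y') z = w_inner \<kappa> lam0 y z + w_inner \<kappa> lam0 y' z"
  by (simp add: w_inner_def algebra_simps add_divide_distrib sum.distrib)

lemma w_inner_add_right: "w_inner \<kappa> lam0 z (y + y') = w_inner \<kappa> lam0 z y + w_inner \<kappa> lam0 z y'"
  by (simp add: w_inner_def algebra_simps add_divide_distrib sum.distrib)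

lemma w_inner_diff_left: "w_inner \<kappa> lam0 (y - y') z = w_inner \<kappa> lam0 y z - w_inner \<kappa> lam0 y' z"
  by (simp add: w_inner_def algebra_simps diff_divide_distrib sum_subtractf)

lemma w_inner_scaleR_left: "w_inner \<kappa> lam0 (c *\<^sub>R y) z = c * w_inner \<kappa> lam0 y z"
  by (simp add: w_inner_def algebra_simps sum_distrib_left)

lemma w_inner_sum_left: "w_inner \<kappa> lam0 (\<Sum>i\<in>A. f i) z = (\<Sum>i\<in>A. w_inner \<kappa> lam0 (f i) z)"
proof (induction A rule: infinite_finite_induct)
  case (insert i A)
  then show ?case by (simp add: w_inner_add_left)
qed (simp_all add: w_inner_def)

lemma w_inner_commute: "w_inner \<kappa> lam0 y z = w_inner \<kappa> lam0 z y"
  by (simp add: w_inner_def mult_ac)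

lemma pf_objective_eq:
  assumes "\<And>r. 0 < n $ r \<Longrightarrow> 0 < y $ r"
  shows "pf_objective \<kappa> n y = ereal (\<Sum>r\<in>UNIV. \<kappa> $ r * real (n $ r) * ln (y $ r))"
proof -
  have "ereal (\<kappa> $ r * real (n $ r)) * ext_log (y $ r) = ereal (\<kappa> $ r * real (n $ r) * ln (y $ r))" for r
    using assms[of r] by (cases "n $ r = 0") (auto simp: ext_log_def zero_ereal_def[symmetric])
  then show ?thesis by (simp add: pf_objective_def)
qed

text \<open>One summand is -\<infinity>, and no summand is \<infinity>, which would absorb it in
  \<open>ereal\<close>.\<close>

lemma pf_objective_minus_infinity:
  assumes \<kappa>: "\<And>r. 0 < \<kappa> $ r" and r: "0 < n $ r" "y $ r \<le> 0"
  shows "pf_objective \<kappa> n y = -\<infinity>"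
proof -
  let ?t = "\<lambda>r. ereal (\<kappa> $ r * real (n $ r)) * ext_log (y $ r)"
  have "?t i \<noteq> \<infinity>" for i
    using mult_nonneg_nonneg[OF less_imp_le[OF \<kappa>[of i]] of_nat_0_le_iff[of "n $ i"]]
    by (auto simp: ext_log_def)
  then have "sum ?t (UNIV - {r}) \<noteq> \<infinity>" by (simp add: sum_Pinfty)
  moreover have "?t r = -\<infinity>"
    using r \<kappa>[of r] by (auto simp: ext_log_def)
  ultimately show ?thesis
    unfolding pf_objective_def by (subst sum.remove[of _ r]) auto
qed

text \<open>Double counting over incident pairs: prices summed along routes and weighted by traffic
  equal link prices weighted by link loads.\<close>

lemma sum_incidence:
  fixes p :: "'l::finite \<Rightarrow> real" and y :: "'r::finite \<Rightarrow> real"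
  shows "(\<Sum>r\<in>UNIV. (\<Sum>l\<in>links r. p l) * y r) = (\<Sum>l\<in>UNIV. p l * (\<Sum>r | l \<in> links r. y r))"
proof -
  have "(\<Sum>r\<in>UNIV. (\<Sum>l\<in>links r. p l) * y r) = (\<Sum>r\<in>UNIV. \<Sum>l | l \<in> links r. p l * y r)"
    by (simp add: sum_distrib_right)
  also have "\<dots> = (\<Sum>l\<in>UNIV. \<Sum>r | l \<in> links r. p l * y r)"
    using sum.swap_restrict[of UNIV UNIV "\<lambda>r l. p l * y r" "\<lambda>r l. l \<in> links r"] by simp
  finally show ?thesis by (simp add: sum_distrib_left)
qed

text \<open>Neither \<epsilon> nor the stationary law is fixed here; both are quantified after the
  constants in the moment lemmas, which makes those constants uniform.\<close>

locale pf_network =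
  fixes links :: "'r::finite \<Rightarrow> 'l::finite set"
    and C :: "real^'l"
    and \<kappa> \<mu> lam0 :: "real^'r"
    and Ls :: "'l set"
    and x :: "nat^'r \<Rightarrow> real^'r"
  assumes C_pos: "\<And>l. 0 < C $ l"
    and links_nonempty: "\<And>r. links r \<noteq> {}"
    and \<kappa>_pos: "\<And>r. 0 < \<kappa> $ r"
    and \<mu>_pos: "\<And>r. 0 < \<mu> $ r"
    and lam0_pos: "\<And>r. 0 < lam0 $ r"
    and critical: "\<And>l. l \<in> Ls \<Longrightarrow> (\<Sum>r | l \<in> links r. lam0 $ r / \<mu> $ r) = C $ l"
    and subcritical: "\<And>l. l \<notin> Ls \<Longrightarrow> (\<Sum>r | l \<in> links r. lam0 $ r / \<mu> $ r) < C $ l"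
    and pf: "weighted_proportionally_fair links C \<kappa> x"
begin

definition \<rho> :: "'r \<Rightarrow> real" where "\<rho> r = lam0 $ r / \<mu> $ r"

definition alloc :: "nat^'r \<Rightarrow> 'r \<Rightarrow> real" where "alloc n r = real (n $ r) * x n $ r"

definition slack :: "'l \<Rightarrow> real" where "slack l = C $ l - (\<Sum>r | l \<in> links r. \<rho> r)"

text \<open>Mean velocity of the flow counts at the critical arrival rates \<open>lam0\<close>; the
  correction for arrival rates reduced by \<epsilon> enters in
  \<open>drift_direction\<close>.\<close>

definition imbalance :: "nat^'r \<Rightarrow> real^'r" where
  "imbalance n = (\<chi> r. lam0 $ r - \<mu> $ r * alloc n r)"

abbreviation ip :: "real^'r \<Rightarrow> real^'r \<Rightarrow> real" where "ip \<equiv> w_inner \<kappa> lam0"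

abbreviation cone :: "(real^'r) set" where "cone \<equiv> ssc_cone links \<kappa> lam0 \<mu> Ls"

abbreviation total :: "nat^'r \<Rightarrow> real" where
  "total n \<equiv> \<Sum>r\<in>UNIV. \<kappa> $ r * real (n $ r)"

section \<open>Feasibility, optimality and KKT conditions of the allocation\<close>

lemma \<rho>_pos: "0 < \<rho> r"
  using lam0_pos[of r] \<mu>_pos[of r] by (simp add: \<rho>_def)

lemma slack_critical: "l \<in> Ls \<Longrightarrow> slack l = 0"
  using critical[of l] by (simp add: slack_def \<rho>_def)

lemma slack_subcritical: "l \<notin> Ls \<Longrightarrow> 0 < slack l"
  using subcritical[of l] by (simp add: slack_def \<rho>_def)

lemma slack_nonneg: "0 \<le> slack l"
  using slack_critical[of l] slack_subcritical[of l] by (cases "l \<in> Ls") auto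

lemma x_feasible: "pf_feasible links C n (x n)"
  using pf by (simp add: weighted_proportionally_fair_def is_arg_max_def)

lemma x_optimal: "pf_feasible links C n y \<Longrightarrow> pf_objective \<kappa> n y \<le> pf_objective \<kappa> n (x n)"
  using pf by (simp add: weighted_proportionally_fair_def is_arg_max_linorder)

lemma x_nonneg: "0 \<le> x n $ r"
  using x_feasible by (simp add: pf_feasible_def)

lemma x_zero: "n $ r = 0 \<Longrightarrow> x n $ r = 0"
  using x_feasible by (simp add: pf_feasible_def)

lemma alloc_load: "(\<Sum>r | l \<in> links r. alloc n r) \<le> C $ l"
  using x_feasible by (simp add: pf_feasible_def alloc_def)

lemma alloc_nonneg: "0 \<le> alloc n r"
  by (simp add: alloc_def x_nonneg)

lemma alloc_le: "alloc n r \<le> (\<Sum>l\<in>UNIV. C $ l)"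
proof -
  obtain l where l: "l \<in> links r" using links_nonempty[of r] by blast
  have "alloc n r \<le> (\<Sum>r | l \<in> links r. alloc n r)"
    using l alloc_nonneg by (intro member_le_sum) auto
  also have "\<dots> \<le> C $ l" by (rule alloc_load)
  also have "\<dots> \<le> (\<Sum>l\<in>UNIV. C $ l)"
    using C_pos by (intro member_le_sum) (auto intro: less_imp_le)
  finally show ?thesis .
qed

text \<open>A zero rate on an occupied route makes the objective -\<infinity>, while a small common
  rate on all occupied routes is feasible and has a finite objective.\<close>

lemma x_pos:
  assumes "0 < n $ r"
  shows "0 < x n $ r"
proof (rule ccontr)
  assume "\<not> 0 < x n $ r"
  then have inf: "pf_objective \<kappa> n (x n) = -\<infinity>"
    using assms \<kappa>_pos by (intro pf_objective_minus_infinity[where r=r]) auto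
  obtain d where d: "0 < d" "\<And>l. d \<le> C $ l"
    using finite_positive_lower_bound[of UNIV "\<lambda>l. C $ l"] C_pos by auto
  define N where "N = (\<Sum>r\<in>UNIV. real (n $ r))"
  have N: "0 \<le> N" by (auto simp: N_def intro: sum_nonneg)
  \<comment> \<open>The load of any link is at most \<open>N * d / (1 + N)\<close>, hence below
    every capacity; the summand 1 also covers \<open>N = 0\<close>.\<close>
  define y where "y = (\<chi> r. if n $ r = 0 then 0 else d / (1 + N))"
  have y_pos: "0 < n $ r \<Longrightarrow> 0 < y $ r" for r using d N by (simp add: y_def)
  have "(\<Sum>r | l \<in> links r. real (n $ r) * y $ r) \<le> C $ l" for l
  proof -
    have "(\<Sum>r | l \<in> links r. real (n $ r) * y $ r) \<le> (\<Sum>r\<in>UNIV. real (n $ r) * y $ r)"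
      using d N by (intro sum_mono2) (auto simp: y_def)
    also have "\<dots> \<le> (\<Sum>r\<in>UNIV. real (n $ r) * (d / (1 + N)))"
      by (intro sum_mono) (auto simp: y_def)
    also have "\<dots> = N * d / (1 + N)" by (simp add: N_def sum_distrib_right[symmetric] sum_divide_distrib[symmetric])
    also have "\<dots> \<le> d" using d N by (simp add: field_simps)
    finally show ?thesis using d(2)[of l] by simp
  qed
  then have "pf_feasible links C n y"
    using d N by (auto simp: pf_feasible_def y_def)
  from x_optimal[OF this] show False
    unfolding inf by (simp add: pf_objective_eq y_pos)
qed

text \<open>First-order optimality along the segment from \<open>x n\<close> to \<open>y\<close>.
  The logarithmic inequality \<open>ln_diff_le\<close> gives it with denominators
  \<open>z t r\<close> for each small \<open>t\<close>, and \<open>t\<close> then tends to 0. Empty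
  routes contribute 0 because of the factor \<open>n $ r\<close>.\<close>

lemma variational_inequality:
  assumes y: "pf_feasible links C n y"
  shows "(\<Sum>r\<in>UNIV. \<kappa> $ r * real (n $ r) * ((y $ r - x n $ r) / x n $ r)) \<le> 0"
proof -
  define z where "z t r = x n $ r + t * (y $ r - x n $ r)" for t r
  define S where "S t = (\<Sum>r\<in>UNIV. \<kappa> $ r * real (n $ r) * ((y $ r - x n $ r) / z t r))" for t
  have y0: "0 \<le> y $ r" for r using y by (simp add: pf_feasible_def)
  have "S t \<le> 0" if t: "0 < t" "t < 1" for t
  proof -
    have z_conv: "z t r = (1 - t) * x n $ r + t * y $ r" for r by (simp add: z_def algebra_simps)
    have z_pos: "0 < z t r" if "0 < n $ r" for r
      unfolding z_conv using x_pos[OF that] y0[of r] t by (intro add_pos_nonneg) auto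
    have feas: "pf_feasible links C n (\<chi> r. z t r)"
      unfolding pf_feasible_def
    proof (intro conjI allI impI)
      fix l
      have "(\<Sum>r | l \<in> links r. real (n $ r) * (\<chi> r. z t r) $ r) =
          (1 - t) * (\<Sum>r | l \<in> links r. real (n $ r) * x n $ r) +
          t * (\<Sum>r | l \<in> links r. real (n $ r) * y $ r)"
        by (simp add: z_conv sum_distrib_left sum.distrib[symmetric] algebra_simps)
      also have "\<dots> \<le> (1 - t) * C $ l + t * C $ l"
        using t x_feasible y by (intro add_mono mult_left_mono) (auto simp: pf_feasible_def)
      finally show "(\<Sum>r | l \<in> links r. real (n $ r) * (\<chi> r. z t r) $ r) \<le> C $ l"
        by (simp add: algebra_simps)
    next
      fix r
      show "0 \<le> (\<chi> r. z t r) $ r" using t y0 x_nonneg by (simp add: z_conv)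
      show "(\<chi> r. z t r) $ r = 0" if "n $ r = 0"
        using that y x_zero by (simp add: z_def pf_feasible_def)
    qed
    have "0 \<le> (\<Sum>r\<in>UNIV. \<kappa> $ r * real (n $ r) * (ln (x n $ r) - ln (z t r)))"
      using x_optimal[OF feas] x_pos z_pos
      by (simp add: pf_objective_eq right_diff_distrib sum_subtractf)
    also have "\<dots> \<le> (\<Sum>r\<in>UNIV. \<kappa> $ r * real (n $ r) * (- t * ((y $ r - x n $ r) / z t r)))"
    proof (intro sum_mono)
      fix r
      show "\<kappa> $ r * real (n $ r) * (ln (x n $ r) - ln (z t r)) \<le>
          \<kappa> $ r * real (n $ r) * (- t * ((y $ r - x n $ r) / z t r))"
      proof (cases "n $ r = 0")
        case False
        then have "ln (x n $ r) - ln (z t r) \<le> (x n $ r - z t r) / z t r"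
          using x_pos[of n r] z_pos[of r] by (intro ln_diff_le) auto
        also have "\<dots> = - t * ((y $ r - x n $ r) / z t r)"
          by (simp add: z_def)
        finally show ?thesis
          using \<kappa>_pos[of r] by (intro mult_left_mono) auto
      qed simp
    qed
    also have "\<dots> = - t * S t"
      by (simp add: S_def sum_distrib_left algebra_simps sum_negf[symmetric])
    finally show ?thesis using t by (simp add: zero_le_mult_iff mult_le_0_iff)
  qed
  then have ev: "\<forall>\<^sub>F t in at_right 0. S t \<le> 0"
    by (auto simp: eventually_at_right_field intro!: exI[of _ 1])
  have "((\<lambda>t. \<kappa> $ r * real (n $ r) * ((y $ r - x n $ r) / z t r)) \<longlongrightarrow>
      \<kappa> $ r * real (n $ r) * ((y $ r - x n $ r) / x n $ r)) (at_right 0)" for r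
  proof (cases "n $ r = 0")
    case False
    have "((\<lambda>t. z t r) \<longlongrightarrow> x n $ r + 0 * (y $ r - x n $ r)) (at_right 0)"
      unfolding z_def by (intro tendsto_intros)
    then have "((\<lambda>t. z t r) \<longlongrightarrow> x n $ r) (at_right 0)" by simp
    then show ?thesis using x_pos[of n r] False by (intro tendsto_intros) auto
  qed simp
  then have "(S \<longlongrightarrow> (\<Sum>r\<in>UNIV. \<kappa> $ r * real (n $ r) * ((y $ r - x n $ r) / x n $ r))) (at_right 0)"
    unfolding S_def by (intro tendsto_sum)
  then show ?thesis by (rule tendsto_upperbound[OF _ ev]) simp
qed

text \<open>Farkas' lemma in the coordinates \<open>alloc n r\<close> of the occupied routes:
  \<open>v\<close> is the gradient of the objective there, \<open>a l\<close> the gradient of the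
  load of link \<open>l\<close>, and \<open>L\<close> the set of saturated links.\<close>

lemma kkt_multipliers:
  obtains p :: "'l \<Rightarrow> real" where "\<And>l. 0 \<le> p l"
    and "\<And>r. alloc n r * (\<Sum>l\<in>links r. p l) = \<kappa> $ r * real (n $ r)"
    and "\<And>l. p l * (C $ l - (\<Sum>r | l \<in> links r. alloc n r)) = 0"
proof -
  define L where "L = {l. (\<Sum>r | l \<in> links r. alloc n r) = C $ l}"
  define a :: "'l \<Rightarrow> real^'r" where "a l = (\<chi> r. if l \<in> links r \<and> 0 < n $ r then 1 else 0)" for l
  define v :: "real^'r" where "v = (\<chi> r. if 0 < n $ r then \<kappa> $ r / x n $ r else 0)"
  have dual: "d \<bullet> v \<le> 0" if d: "\<forall>l\<in>L. d \<bullet> a l \<le> 0" for d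
  proof -
    \<comment> \<open>The direction \<open>d\<close> perturbs allocations, so per-flow rates change
      by \<open>d $ r / n $ r\<close>. For small \<open>t\<close> this is feasible: saturated links
      do not gain load, the others have room.\<close>
    define y where "y t = (\<chi> r. x n $ r + (if 0 < n $ r then t * (d $ r / real (n $ r)) else 0))" for t :: real
    have da: "d \<bullet> a l = (\<Sum>r | l \<in> links r. if 0 < n $ r then d $ r else 0)" for l
      unfolding inner_vec_def a_def by (rule sum.mono_neutral_cong_right) auto
    have load: "(\<Sum>r | l \<in> links r. real (n $ r) * y t $ r) =
        (\<Sum>r | l \<in> links r. alloc n r) + t * (d \<bullet> a l)" for l t
      unfolding da sum_distrib_left sum.distrib[symmetric]
      by (intro sum.cong) (auto simp: y_def alloc_def algebra_simps)
    have "\<forall>\<^sub>F t in at_right 0. \<forall>l. (\<Sum>r | l \<in> links r. real (n $ r) * y t $ r) \<le> C $ l"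
    proof (intro eventually_all_finite)
      fix l
      show "\<forall>\<^sub>F t in at_right 0. (\<Sum>r | l \<in> links r. real (n $ r) * y t $ r) \<le> C $ l"
      proof (cases "l \<in> L")
        case True
        then show ?thesis
          unfolding load using d
          by (auto simp: L_def eventually_at_right_field intro!: exI[of _ 1] mult_nonneg_nonpos)
      next
        case False
        have "((\<lambda>t. (\<Sum>r | l \<in> links r. alloc n r) + t * (d \<bullet> a l)) \<longlongrightarrow>
            (\<Sum>r | l \<in> links r. alloc n r) + 0 * (d \<bullet> a l)) (at_right 0)"
          by (intro tendsto_intros)
        moreover have "(\<Sum>r | l \<in> links r. alloc n r) + 0 * (d \<bullet> a l) < C $ l"
          using False alloc_load[where l=l and n=n] by (auto simp: L_def)
        ultimately have "\<forall>\<^sub>F t in at_right 0.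
            (\<Sum>r | l \<in> links r. alloc n r) + t * (d \<bullet> a l) < C $ l"
          by (rule order_tendstoD(2))
        then show ?thesis
          unfolding load by (rule eventually_mono) simp
      qed
    qed
    moreover have "\<forall>\<^sub>F t in at_right 0. \<forall>r. 0 \<le> y t $ r"
    proof (intro eventually_all_finite)
      fix r
      show "\<forall>\<^sub>F t in at_right 0. 0 \<le> y t $ r"
      proof (cases "0 < n $ r")
        case True
        have "((\<lambda>t. x n $ r + t * (d $ r / real (n $ r))) \<longlongrightarrow>
            x n $ r + 0 * (d $ r / real (n $ r))) (at_right 0)"
          by (intro tendsto_intros)
        then have "\<forall>\<^sub>F t in at_right 0. 0 < x n $ r + t * (d $ r / real (n $ r))"
          using x_pos[OF True] by (intro order_tendstoD(1)) auto
        then show ?thesis using True by (auto simp: y_def elim: eventually_mono)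
      qed (simp add: y_def x_nonneg)
    qed
    moreover have "\<forall>\<^sub>F t in at_right (0::real). 0 < t" by (rule eventually_at_right_less)
    ultimately have "\<forall>\<^sub>F t in at_right 0. 0 < t \<and> pf_feasible links C n (y t)"
      by eventually_elim (auto simp: pf_feasible_def y_def x_zero)
    then obtain t where t: "0 < t" "pf_feasible links C n (y t)"
      using eventually_happens'[OF trivial_limit_at_right_real] by blast
    have "(\<Sum>r\<in>UNIV. \<kappa> $ r * real (n $ r) * ((y t $ r - x n $ r) / x n $ r)) = t * (d \<bullet> v)"
      unfolding inner_vec_def v_def sum_distrib_left by (intro sum.cong) (auto simp: y_def)
    with variational_inequality[OF t(2)] t(1) show ?thesis
      by (simp add: mult_le_0_iff)
  qed
  obtain \<alpha> where \<alpha>: "\<forall>l\<in>L. 0 \<le> \<alpha> l" "v = (\<Sum>l\<in>L. \<alpha> l *\<^sub>R a l)"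
    using farkas[of L a v] dual by auto
  \<comment> \<open>Price 0 on unsaturated links is complementary slackness.\<close>
  define p where "p l = (if l \<in> L then \<alpha> l else 0)" for l
  show thesis
  proof
    show "0 \<le> p l" for l using \<alpha> by (simp add: p_def)
    show "p l * (C $ l - (\<Sum>r | l \<in> links r. alloc n r)) = 0" for l
      by (simp add: p_def L_def)
    show "alloc n r * (\<Sum>l\<in>links r. p l) = \<kappa> $ r * real (n $ r)" for r
    proof (cases "0 < n $ r")
      case True
      have "\<kappa> $ r / x n $ r = v $ r" using True by (simp add: v_def)
      also have "\<dots> = (\<Sum>l\<in>L. \<alpha> l *\<^sub>R a l) $ r" by (rule arg_cong[OF \<alpha>(2)])
      also have "\<dots> = (\<Sum>l\<in>L. if l \<in> links r then \<alpha> l else 0)"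
        using True by (auto simp: a_def intro!: sum.cong)
      also have "\<dots> = (\<Sum>l\<in>links r. p l)"
        unfolding p_def by (simp add: sum.inter_restrict[symmetric] Int_commute)
      finally have "(\<Sum>l\<in>links r. p l) = \<kappa> $ r / x n $ r" ..
      with x_pos[OF True] show ?thesis by (simp add: alloc_def)
    qed (simp add: alloc_def)
  qed
qed

subsection \<open>Distance to the cone\<close>

lemma ip_nonneg: "0 \<le> ip y y"
  unfolding w_inner_def using \<kappa>_pos lam0_pos
  by (intro sum_nonneg) (auto simp: mult.assoc less_imp_le)

lemma ip_imbalance_cone:
  assumes "k \<in> cone"
  shows "0 \<le> ip k (imbalance n)"
proof -
  obtain \<alpha> where \<alpha>: "\<forall>l\<in>Ls. 0 \<le> \<alpha> l"
    and k: "k = (\<Sum>l\<in>Ls. \<alpha> l *\<^sub>R cone_gen links \<kappa> lam0 \<mu> l)"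
    using assms by (auto simp: ssc_cone_def)
  have "0 \<le> ip (cone_gen links \<kappa> lam0 \<mu> l) (imbalance n)" if l: "l \<in> Ls" for l
  proof -
    have "ip (cone_gen links \<kappa> lam0 \<mu> l) (imbalance n) =
        (\<Sum>r | l \<in> links r. \<rho> r - alloc n r)"
      unfolding w_inner_def
    proof (rule sum.mono_neutral_cong_right)
      fix r assume "r \<in> {r. l \<in> links r}"
      then show "\<kappa> $ r / lam0 $ r * cone_gen links \<kappa> lam0 \<mu> l $ r * imbalance n $ r = \<rho> r - alloc n r"
        using \<kappa>_pos[of r] lam0_pos[of r] \<mu>_pos[of r]
        by (simp add: cone_gen_def imbalance_def \<rho>_def field_simps)
    qed (auto simp: cone_gen_def)
    also have "\<dots> = C $ l - (\<Sum>r | l \<in> links r. alloc n r)"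
      using slack_critical[OF l] by (simp add: slack_def sum_subtractf)
    finally show ?thesis using alloc_load[where l=l and n=n] by simp
  qed
  with \<alpha> show ?thesis
    unfolding k by (auto simp: w_inner_sum_left w_inner_scaleR_left intro!: sum_nonneg)
qed

text \<open>After replacing \<open>\<kappa> $ r * n $ r\<close> by allocation times price, each
  summand splits into a square and a term linear in \<open>alloc n r - \<rho> r\<close>. The linear
  terms are regrouped by link, where complementary slackness turns them into
  \<open>p l * slack l\<close>.\<close>

lemma ip_imbalance_eq:
  assumes p: "\<And>r. alloc n r * (\<Sum>l\<in>links r. p l) = \<kappa> $ r * real (n $ r)"
    and compl: "\<And>l. p l * (C $ l - (\<Sum>r | l \<in> links r. alloc n r)) = 0"
  shows "ip (real_state n) (imbalance n) =
    - ((\<Sum>r\<in>UNIV. (\<Sum>l\<in>links r. p l) * (alloc n r - \<rho> r)\<^sup>2 / \<rho> r) + (\<Sum>l\<in>UNIV. p l * slack l))"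
proof -
  define P where "P r = (\<Sum>l\<in>links r. p l)" for r
  have "ip (real_state n) (imbalance n) =
      (\<Sum>r\<in>UNIV. - (P r * (alloc n r - \<rho> r)\<^sup>2 / \<rho> r) - P r * (alloc n r - \<rho> r))"
    unfolding w_inner_def
  proof (rule sum.cong)
    fix r
    have lam: "lam0 $ r = \<mu> $ r * \<rho> r" using \<mu>_pos[of r] by (simp add: \<rho>_def)
    have "\<kappa> $ r / lam0 $ r * real_state n $ r * imbalance n $ r =
        (\<kappa> $ r * real (n $ r)) * (lam0 $ r - \<mu> $ r * alloc n r) / lam0 $ r"
      by (simp add: real_state_def imbalance_def)
    also have "\<dots> = alloc n r * P r * (\<rho> r - alloc n r) / \<rho> r"
      unfolding p[symmetric] P_def[symmetric] lam using \<rho>_pos[of r] \<mu>_pos[of r]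
      by (simp add: field_simps)
    also have "\<dots> = - (P r * (alloc n r - \<rho> r)\<^sup>2 / \<rho> r) - P r * (alloc n r - \<rho> r)"
      using \<rho>_pos[of r] by (simp add: field_simps power2_eq_square)
    finally show "\<kappa> $ r / lam0 $ r * real_state n $ r * imbalance n $ r =
        - (P r * (alloc n r - \<rho> r)\<^sup>2 / \<rho> r) - P r * (alloc n r - \<rho> r)" .
  qed simp
  also have "\<dots> = - (\<Sum>r\<in>UNIV. P r * (alloc n r - \<rho> r)\<^sup>2 / \<rho> r) - (\<Sum>r\<in>UNIV. P r * (alloc n r - \<rho> r))"
    by (simp add: sum_subtractf sum_negf)
  also have "(\<Sum>r\<in>UNIV. P r * (alloc n r - \<rho> r)) =
      (\<Sum>l\<in>UNIV. p l * (\<Sum>r | l \<in> links r. alloc n r - \<rho> r))"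
    unfolding P_def by (rule sum_incidence)
  also have "\<dots> = (\<Sum>l\<in>UNIV. p l * slack l)"
  proof (rule sum.cong)
    fix l
    show "p l * (\<Sum>r | l \<in> links r. alloc n r - \<rho> r) = p l * slack l"
      using compl[of l] by (auto simp: slack_def sum_subtractf)
  qed simp
  finally show ?thesis by (simp add: P_def)
qed

lemma ip_state_imbalance_nonpos: "ip (real_state n) (imbalance n) \<le> 0"
proof -
  obtain p where p: "\<And>l. 0 \<le> p l" "\<And>r. alloc n r * (\<Sum>l\<in>links r. p l) = \<kappa> $ r * real (n $ r)"
    "\<And>l. p l * (C $ l - (\<Sum>r | l \<in> links r. alloc n r)) = 0"
    by (rule kkt_multipliers[where n=n]) (rule that)
  have "0 \<le> (\<Sum>r\<in>UNIV. (\<Sum>l\<in>links r. p l) * (alloc n r - \<rho> r)\<^sup>2 / \<rho> r)"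
    using p(1) \<rho>_pos by (intro sum_nonneg divide_nonneg_pos mult_nonneg_nonneg) auto
  moreover have "0 \<le> (\<Sum>l\<in>UNIV. p l * slack l)"
    using p(1) slack_nonneg by (intro sum_nonneg mult_nonneg_nonneg) auto
  ultimately show ?thesis using ip_imbalance_eq[OF p(2,3)] by simp
qed

text \<open>The witness in the cone is \<open>\<Sum>\<^sub>\<ell> p\<^sub>\<ell> b\<^sup>(\<^sup>\<ell>\<^sup>)\<close> over the critical links, where \<open>p\<close> are the KKT
  multipliers of the allocation in state \<open>n\<close>.\<close>

lemma near_cone:
  obtains c where "0 < c" and
    "\<And>n. \<exists>k\<in>cone. ip (real_state n - k) (real_state n - k) \<le>
       c * total n * - ip (real_state n) (imbalance n)"
proof -
  obtain d where d: "0 < d" "\<And>l. d \<le> C $ l"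
    using finite_positive_lower_bound[of UNIV "\<lambda>l. C $ l"] C_pos by auto
  obtain s where s: "0 < s" "\<And>l. l \<notin> Ls \<Longrightarrow> s \<le> slack l"
    using finite_positive_lower_bound[of "- Ls" slack] slack_subcritical by auto
  define A1 where "A1 = (\<Sum>r\<in>UNIV. 1 / (\<kappa> $ r * \<mu> $ r))"
  define A2 where "A2 = (\<Sum>r\<in>UNIV. (\<rho> r)\<^sup>2 / (\<kappa> $ r * lam0 $ r))"
  have A1: "1 / (\<kappa> $ r * \<mu> $ r) \<le> A1" for r
    unfolding A1_def using \<kappa>_pos \<mu>_pos by (intro member_le_sum) (auto simp: less_imp_le)
  have A1_nonneg: "0 \<le> A1"
    unfolding A1_def using \<kappa>_pos \<mu>_pos by (intro sum_nonneg) (auto simp: less_imp_le)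
  have A2_nonneg: "0 \<le> A2"
    unfolding A2_def using \<kappa>_pos lam0_pos by (intro sum_nonneg) (auto simp: less_imp_le)
  \<comment> \<open>The factors 2 come from
    \<open>(a + b)\<^sup>2 \<le> 2 * a\<^sup>2 + 2 * b\<^sup>2\<close>, the divisors from bounding
    prices by \<open>total n / d\<close> and noncritical prices by \<open>S / s\<close>; the 1
    ensures positivity.\<close>
  define c where "c = 2 * A1 / d + 2 * A2 / (d * s) + 1"
  show thesis
  proof
    show "0 < c" using A1_nonneg A2_nonneg d s by (auto simp: c_def intro!: add_nonneg_pos)
    fix n
    obtain p where p0: "\<And>l. 0 \<le> p l"
      and p: "\<And>r. alloc n r * (\<Sum>l\<in>links r. p l) = \<kappa> $ r * real (n $ r)"
      and compl: "\<And>l. p l * (C $ l - (\<Sum>r | l \<in> links r. alloc n r)) = 0"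
      by (rule kkt_multipliers[where n=n]) (rule that)
    \<comment> \<open>\<open>P\<close> is the price of a whole route, \<open>Q\<close> its part on
      noncritical links, which the witness \<open>k\<close> leaves out.\<close>
    define P where "P r = (\<Sum>l\<in>links r. p l)" for r
    define Q where "Q r = (\<Sum>l\<in>links r - Ls. p l)" for r
    define E where "E = (\<Sum>r\<in>UNIV. P r * (alloc n r - \<rho> r)\<^sup>2 / \<rho> r)"
    define S where "S = (\<Sum>l\<in>UNIV. p l * slack l)"
    define k where "k = (\<Sum>l\<in>Ls. p l *\<^sub>R cone_gen links \<kappa> lam0 \<mu> l)"
    have k_cone: "k \<in> cone" using p0 by (auto simp: k_def ssc_cone_def)
    have P0: "0 \<le> P r" and Q0: "0 \<le> Q r" for r
      using p0 by (auto simp: P_def Q_def intro: sum_nonneg)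
    have E0: "0 \<le> E" unfolding E_def using P0 \<rho>_pos by (intro sum_nonneg) (auto simp: less_imp_le)
    have S0: "0 \<le> S" unfolding S_def using p0 slack_nonneg by (intro sum_nonneg) auto
    have total0: "0 \<le> total n" using \<kappa>_pos by (intro sum_nonneg) (auto simp: less_imp_le)
    \<comment> \<open>By complementary slackness \<open>total n\<close> is the total price of the
      capacities, so the prices sum to at most \<open>total n / d\<close>.\<close>
    have "total n = (\<Sum>r\<in>UNIV. P r * alloc n r)"
      by (simp add: p[symmetric] P_def mult.commute)
    also have "\<dots> = (\<Sum>l\<in>UNIV. p l * (\<Sum>r | l \<in> links r. alloc n r))"
      unfolding P_def by (rule sum_incidence)
    also have "\<dots> = (\<Sum>l\<in>UNIV. p l * C $ l)"
    proof (rule sum.cong)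
      fix l
      show "p l * (\<Sum>r | l \<in> links r. alloc n r) = p l * C $ l"
        using compl[of l] by auto
    qed simp
    finally have "(\<Sum>l\<in>UNIV. p l) * d \<le> total n"
      using d(2) p0 by (auto simp: sum_distrib_right intro!: sum_mono mult_left_mono)
    then have p_le: "(\<Sum>l\<in>UNIV. p l) \<le> total n / d" using d by (simp add: field_simps)
    have P_le: "P r \<le> total n / d" for r
      unfolding P_def using p0 by (intro order_trans[OF sum_mono2 p_le]) auto
    have Q_le: "Q r \<le> total n / d" for r
      unfolding Q_def using p0 by (intro order_trans[OF sum_mono2 p_le]) auto
    have Q_S: "Q r \<le> S / s" for r
    proof -
      have "Q r * s = (\<Sum>l\<in>links r - Ls. p l * s)" by (simp add: Q_def sum_distrib_right)
      also have "\<dots> \<le> (\<Sum>l\<in>links r - Ls. p l * slack l)"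
        using s(2) p0 by (intro sum_mono mult_left_mono) auto
      also have "\<dots> \<le> S"
        unfolding S_def using p0 slack_nonneg by (intro sum_mono2) auto
      finally show ?thesis using s by (simp add: field_simps)
    qed
    have diff: "(real_state n - k) $ r = (alloc n r - \<rho> r) * P r / \<kappa> $ r + \<rho> r / \<kappa> $ r * Q r" for r
    proof -
      have "k $ r = (\<Sum>l\<in>Ls. if l \<in> links r then \<rho> r / \<kappa> $ r * p l else 0)"
        by (auto simp: k_def cone_gen_def \<rho>_def intro!: sum.cong)
      also have "\<dots> = \<rho> r / \<kappa> $ r * (\<Sum>l\<in>Ls \<inter> links r. p l)"
        by (simp add: sum.inter_restrict[symmetric] sum_distrib_left)
      also have "(\<Sum>l\<in>Ls \<inter> links r. p l) = P r - Q r"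
        using sum.Int_Diff[of "links r" p Ls] by (simp add: P_def Q_def Int_commute)
      finally have "k $ r = \<rho> r / \<kappa> $ r * (P r - Q r)" .
      moreover have "real (n $ r) = alloc n r * P r / \<kappa> $ r"
        using p[of r] \<kappa>_pos[of r] by (simp add: P_def field_simps)
      ultimately show ?thesis
        by (simp add: real_state_def algebra_simps diff_divide_distrib)
    qed
    have term_le: "\<kappa> $ r / lam0 $ r * (real_state n - k) $ r * (real_state n - k) $ r \<le>
        2 * (A1 * (total n / d) * (P r * (alloc n r - \<rho> r)\<^sup>2 / \<rho> r))
        + 2 * ((\<rho> r)\<^sup>2 / (\<kappa> $ r * lam0 $ r) * ((total n / d) * (S / s)))" for r
    proof -
      note pos = \<kappa>_pos[of r] \<mu>_pos[of r] lam0_pos[of r] \<rho>_pos[of r]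
      define a where "a = (alloc n r - \<rho> r) * P r / \<kappa> $ r"
      define b where "b = \<rho> r / \<kappa> $ r * Q r"
      have "(a + b)\<^sup>2 \<le> 2 * a\<^sup>2 + 2 * b\<^sup>2"
        using zero_le_power2[of "a - b"] by (simp add: power2_eq_square algebra_simps)
      then have "\<kappa> $ r / lam0 $ r * (a + b)\<^sup>2 \<le> \<kappa> $ r / lam0 $ r * (2 * a\<^sup>2 + 2 * b\<^sup>2)"
        using pos by (intro mult_left_mono) auto
      also have "\<dots> = 2 * (\<kappa> $ r / lam0 $ r * a\<^sup>2) + 2 * (\<kappa> $ r / lam0 $ r * b\<^sup>2)"
        by (simp only: distrib_left mult_ac)
      finally have "\<kappa> $ r / lam0 $ r * (a + b)\<^sup>2 \<le>
          2 * (\<kappa> $ r / lam0 $ r * a\<^sup>2) + 2 * (\<kappa> $ r / lam0 $ r * b\<^sup>2)" .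
      \<comment> \<open>Of the two factors \<open>P r\<close> one is bounded by
        \<open>total n / d\<close>, the other stays in the summand of \<open>E\<close>. For
        \<open>b\<close> likewise one factor \<open>Q r\<close> is bounded by
        \<open>total n / d\<close> and one by \<open>S / s\<close>.\<close>
      moreover have "\<kappa> $ r / lam0 $ r * a\<^sup>2 \<le> A1 * (total n / d) * (P r * (alloc n r - \<rho> r)\<^sup>2 / \<rho> r)"
      proof -
        have "\<kappa> $ r / lam0 $ r * a\<^sup>2 =
            (1 / (\<kappa> $ r * \<mu> $ r)) * P r * (P r * (alloc n r - \<rho> r)\<^sup>2 / \<rho> r)"
          using pos by (simp add: a_def \<rho>_def power2_eq_square field_simps)
        also have "\<dots> \<le> A1 * (total n / d) * (P r * (alloc n r - \<rho> r)\<^sup>2 / \<rho> r)"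
          using A1[of r] A1_nonneg P_le[of r] P0[of r] pos
          by (intro mult_right_mono mult_mono) auto
        finally show ?thesis .
      qed
      moreover have "\<kappa> $ r / lam0 $ r * b\<^sup>2 \<le>
          ((\<rho> r)\<^sup>2 / (\<kappa> $ r * lam0 $ r)) * ((total n / d) * (S / s))"
      proof -
        have "\<kappa> $ r / lam0 $ r * b\<^sup>2 = ((\<rho> r)\<^sup>2 / (\<kappa> $ r * lam0 $ r)) * (Q r * Q r)"
          using pos by (simp add: b_def power2_eq_square field_simps)
        also have "\<dots> \<le> ((\<rho> r)\<^sup>2 / (\<kappa> $ r * lam0 $ r)) * ((total n / d) * (S / s))"
          using Q_le[of r] Q_S[of r] Q0[of r] pos total0 d
          by (intro mult_left_mono mult_mono) auto
        finally show ?thesis .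
      qed
      moreover have "\<kappa> $ r / lam0 $ r * (real_state n - k) $ r * (real_state n - k) $ r =
          \<kappa> $ r / lam0 $ r * (a + b)\<^sup>2"
        unfolding diff a_def[symmetric] b_def[symmetric] by (simp add: power2_eq_square)
      ultimately show ?thesis by linarith
    qed
    have "ip (real_state n - k) (real_state n - k) \<le>
        (\<Sum>r\<in>UNIV. 2 * (A1 * (total n / d) * (P r * (alloc n r - \<rho> r)\<^sup>2 / \<rho> r))
        + 2 * ((\<rho> r)\<^sup>2 / (\<kappa> $ r * lam0 $ r) * ((total n / d) * (S / s))))"
      unfolding w_inner_def by (intro sum_mono term_le)
    also have "\<dots> = 2 * (A1 * (total n / d) * E) + 2 * (A2 * ((total n / d) * (S / s)))"
      by (simp only: sum.distrib sum_distrib_left[symmetric] sum_distrib_right[symmetric]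
          E_def A2_def)
    also have "\<dots> = total n * ((2 * A1 / d) * E + (2 * A2 / (d * s)) * S)"
      using d s by (simp add: field_simps)
    also have "\<dots> \<le> total n * (c * E + c * S)"
      using total0 E0 S0 A1_nonneg A2_nonneg d s
      by (intro mult_left_mono add_mono mult_right_mono) (auto simp: c_def)
    also have "\<dots> = c * total n * (E + S)"
      by (simp only: ring_distribs mult_ac)
    also have "E + S = - ip (real_state n) (imbalance n)"
      using ip_imbalance_eq[OF p compl] by (simp add: E_def S_def P_def)
    finally show "\<exists>k\<in>cone. ip (real_state n - k) (real_state n - k) \<le>
       c * total n * - ip (real_state n) (imbalance n)"
      using k_cone by blast
  qed
qed

lemma zero_in_cone: "0 \<in> cone"
  unfolding ssc_cone_def by (rule CollectI, rule exI[of _ "\<lambda>_. 0"]) simp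

text \<open>\<open>arg_min_on\<close> is a choice, so a minimizer must be shown to exist. The
  scaling \<open>T\<close> turns the weighted norm into the Euclidean one and the cone into a
  finitely generated, hence closed, cone, where the distance is attained.\<close>

lemma par_part_projection:
  shows par_part_in_cone: "par_part links \<kappa> lam0 \<mu> Ls y \<in> cone"
    and perp_part_le: "k \<in> cone \<Longrightarrow>
      ip (perp_part links \<kappa> lam0 \<mu> Ls y) (perp_part links \<kappa> lam0 \<mu> Ls y) \<le> ip (y - k) (y - k)"
proof -
  define T :: "real^'r \<Rightarrow> real^'r" where "T z = (\<chi> r. sqrt (\<kappa> $ r / lam0 $ r) * z $ r)" for z
  have T: "linear T"
    by (rule linearI) (auto simp: T_def vec_eq_iff algebra_simps)
  have norm_T: "w_norm \<kappa> lam0 z = norm (T z)" for z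
  proof -
    have "\<kappa> $ r / lam0 $ r * z $ r * z $ r = T z $ r * T z $ r" for r
    proof -
      have "T z $ r * T z $ r = (sqrt (\<kappa> $ r / lam0 $ r) * sqrt (\<kappa> $ r / lam0 $ r)) * (z $ r * z $ r)"
        unfolding T_def by (simp only: vec_lambda_beta mult_ac)
      also have "sqrt (\<kappa> $ r / lam0 $ r) * sqrt (\<kappa> $ r / lam0 $ r) = \<kappa> $ r / lam0 $ r"
        using \<kappa>_pos[of r] lam0_pos[of r] by (intro real_sqrt_mult_self[THEN trans]) auto
      finally show ?thesis by simp
    qed
    then show ?thesis
      by (simp add: w_norm_def w_inner_def norm_eq_sqrt_inner inner_vec_def)
  qed
  have "closed (T ` cone)"
  proof -
    have "cone = convex_cone hull (cone_gen links \<kappa> lam0 \<mu> ` Ls)"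
      by (simp add: ssc_cone_def convex_cone_hull_finite_image)
    moreover have "T ` (convex_cone hull (cone_gen links \<kappa> lam0 \<mu> ` Ls)) =
        convex_cone hull (T ` cone_gen links \<kappa> lam0 \<mu> ` Ls)"
      using T by (simp add: convex_cone_hull_linear_image)
    ultimately show ?thesis by (simp add: closed_convex_cone_hull)
  qed
  moreover have "T ` cone \<noteq> {}" using zero_in_cone by blast
  ultimately obtain z where "z \<in> T ` cone" "\<And>w. w \<in> T ` cone \<Longrightarrow> dist (T y) z \<le> dist (T y) w"
    using distance_attains_inf[of "T ` cone" "T y"] by metis
  then obtain k0 where k0: "k0 \<in> cone" "\<And>k. k \<in> cone \<Longrightarrow> dist (T y) (T k0) \<le> dist (T y) (T k)"
    by blast
  have dist_T: "dist (T y) (T k) = w_norm \<kappa> lam0 (y - k)" for k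
    by (simp add: dist_norm norm_T linear_diff[OF T])
  have "is_arg_min (\<lambda>k. w_norm \<kappa> lam0 (y - k)) (\<lambda>k. k \<in> cone) k0"
    using k0 by (simp add: is_arg_min_linorder dist_T)
  then have "is_arg_min (\<lambda>k. w_norm \<kappa> lam0 (y - k)) (\<lambda>k. k \<in> cone) (par_part links \<kappa> lam0 \<mu> Ls y)"
    unfolding par_part_def arg_min_on_def arg_min_def by (rule someI)
  then have *: "par_part links \<kappa> lam0 \<mu> Ls y \<in> cone"
    "\<And>k. k \<in> cone \<Longrightarrow> w_norm \<kappa> lam0 (y - par_part links \<kappa> lam0 \<mu> Ls y) \<le> w_norm \<kappa> lam0 (y - k)"
    by (auto simp: is_arg_min_linorder)
  show "par_part links \<kappa> lam0 \<mu> Ls y \<in> cone" by fact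
  show "ip (perp_part links \<kappa> lam0 \<mu> Ls y) (perp_part links \<kappa> lam0 \<mu> Ls y) \<le> ip (y - k) (y - k)"
    if "k \<in> cone"
    using *(2)[OF that] by (simp add: w_norm_def perp_part_def)
qed

subsection \<open>Drift of the flow count process\<close>

definition wt :: "'r \<Rightarrow> real" where "wt r = \<kappa> $ r / lam0 $ r"

text \<open>Bounds arrivals plus departures on a route in every state, for all arrival rates up to
  \<open>lam0\<close>: departures are limited by capacity, not by the number of flows.\<close>

definition rate_bound :: "'r \<Rightarrow> real" where
  "rate_bound r = lam0 $ r + (\<Sum>l\<in>UNIV. C $ l) * \<mu> $ r"

lemma wt_pos: "0 < wt r"
  using \<kappa>_pos[of r] lam0_pos[of r] by (simp add: wt_def)

lemma ip_eq: "ip y z = (\<Sum>r\<in>UNIV. wt r * y $ r * z $ r)"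
  by (simp add: w_inner_def wt_def)

lemma flow_rate_support:
  "{j. j \<noteq> n \<and> flow_rate lam \<mu> x n j \<noteq> 0} \<subseteq>
    range (\<lambda>r. n + axis r 1) \<union> range (\<lambda>r. n - axis r 1)" (is "_ \<subseteq> ?A")
proof (rule subsetI, rule ccontr)
  fix j assume j: "j \<in> {j. j \<noteq> n \<and> flow_rate lam \<mu> x n j \<noteq> 0}" "j \<notin> ?A"
  have "j \<noteq> n + axis r 1" "n \<noteq> j + axis r 1" for r
  proof -
    show "j \<noteq> n + axis r 1" using j(2) by blast
    show "n \<noteq> j + axis r 1"
    proof
      assume "n = j + axis r 1"
      then have "j = n - axis r 1" by simp
      with j(2) show False by blast
    qed
  qed
  then have "flow_rate lam \<mu> x n j = 0" by (simp add: flow_rate_def)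
  with j show False by simp
qed

lemma finite_flow_rate_support: "finite {j. j \<noteq> n \<and> flow_rate lam \<mu> x n j \<noteq> 0}"
  by (rule finite_subset[OF flow_rate_support]) auto

lemma eq_add_axis_iff:
  fixes n j :: "nat^'r"
  assumes "0 < n $ r"
  shows "n = j + axis r 1 \<longleftrightarrow> j = n - axis r 1"
proof
  show "n = j + axis r 1" if "j = n - axis r 1"
    using assms that by (auto simp: vec_eq_iff axis_def)
qed simp

text \<open>Summing over the finite set \<open>A\<close> of neighbours and exchanging sums leaves
  one neighbour per route and direction. Truncated subtraction on an empty route is harmless, as its
  allocation is 0.\<close>

lemma ctmc_drift_flow_rate:
  "ctmc_drift (flow_rate lam \<mu> x) f n =
    (\<Sum>r\<in>UNIV. lam $ r * (f (n + axis r 1) - f n)) +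
    (\<Sum>r\<in>UNIV. alloc n r * \<mu> $ r * (f (n - axis r 1) - f n))"
proof -
  define A where "A = range (\<lambda>r. n + axis r 1) \<union> range (\<lambda>r. n - axis r 1)"
  have A: "finite A" by (simp add: A_def)
  have "ctmc_drift (flow_rate lam \<mu> x) f n = (\<Sum>j\<in>A. flow_rate lam \<mu> x n j * (f j - f n))"
    unfolding ctmc_drift_def
    using flow_rate_support[of n lam] A by (intro sum.mono_neutral_left) (auto simp: A_def)
  also have "\<dots> = (\<Sum>j\<in>A. \<Sum>r\<in>UNIV. (if j = n + axis r 1 then lam $ r * (f j - f n) else 0) +
      (if n = j + axis r 1 then alloc n r * \<mu> $ r * (f j - f n) else 0))"
    unfolding flow_rate_def sum_distrib_right
    by (intro sum.cong) (auto simp: alloc_def distrib_right)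
  also have "\<dots> = (\<Sum>r\<in>UNIV. \<Sum>j\<in>A. (if j = n + axis r 1 then lam $ r * (f j - f n) else 0) +
      (if n = j + axis r 1 then alloc n r * \<mu> $ r * (f j - f n) else 0))"
    by (rule sum.swap)
  also have "\<dots> = (\<Sum>r\<in>UNIV. lam $ r * (f (n + axis r 1) - f n) +
      alloc n r * \<mu> $ r * (f (n - axis r 1) - f n))"
  proof (rule sum.cong)
    fix r
    have "(\<Sum>j\<in>A. if j = n + axis r 1 then lam $ r * (f j - f n) else 0) =
        lam $ r * (f (n + axis r 1) - f n)"
      using A by (simp add: sum.delta A_def)
    moreover have "(\<Sum>j\<in>A. if n = j + axis r 1 then alloc n r * \<mu> $ r * (f j - f n) else 0) =
        alloc n r * \<mu> $ r * (f (n - axis r 1) - f n)"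
    proof (cases "0 < n $ r")
      case True
      then show ?thesis using A unfolding eq_add_axis_iff[OF True] by (simp add: sum.delta A_def)
    next
      case False
      then have "alloc n r * \<mu> $ r = 0" by (simp add: alloc_def)
      then show ?thesis unfolding \<open>alloc n r * \<mu> $ r = 0\<close> mult_zero_left if_cancel by simp
    qed
    ultimately show "(\<Sum>j\<in>A. (if j = n + axis r 1 then lam $ r * (f j - f n) else 0) +
        (if n = j + axis r 1 then alloc n r * \<mu> $ r * (f j - f n) else 0)) =
        lam $ r * (f (n + axis r 1) - f n) + alloc n r * \<mu> $ r * (f (n - axis r 1) - f n)"
      by (simp add: sum.distrib)
  qed simp
  finally show ?thesis by (simp add: sum.distrib)
qed

lemma alloc_rate_le: "alloc n r * \<mu> $ r \<le> (\<Sum>l\<in>UNIV. C $ l) * \<mu> $ r"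
  using alloc_le[of n r] \<mu>_pos[of r] by (intro mult_right_mono) auto

lemma C_sum_nonneg: "0 \<le> (\<Sum>l\<in>UNIV. C $ l)"
  using C_pos by (intro sum_nonneg) (auto intro: less_imp_le)

lemma exit_rate_le:
  assumes lam: "\<And>r. 0 \<le> lam $ r" "\<And>r. lam $ r \<le> lam0 $ r"
  shows "(\<Sum>j | j \<noteq> n \<and> flow_rate lam \<mu> x n j \<noteq> 0. flow_rate lam \<mu> x n j) \<le> (\<Sum>r\<in>UNIV. rate_bound r)"
proof -
  \<comment> \<open>The exit rate is the drift at \<open>n\<close> of the indicator of having left
    \<open>n\<close>.\<close>
  define f where "f j = (if j = n then 0 else 1 :: real)" for j
  have f: "0 \<le> f j" "f j \<le> 1" for j by (auto simp: f_def)
  have "(\<Sum>j | j \<noteq> n \<and> flow_rate lam \<mu> x n j \<noteq> 0. flow_rate lam \<mu> x n j) =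
      ctmc_drift (flow_rate lam \<mu> x) f n"
    unfolding ctmc_drift_def by (intro sum.cong) (auto simp: f_def)
  also have "\<dots> = (\<Sum>r\<in>UNIV. lam $ r * f (n + axis r 1) + alloc n r * \<mu> $ r * f (n - axis r 1))"
    by (simp add: ctmc_drift_flow_rate sum.distrib f_def)
  also have "\<dots> \<le> (\<Sum>r\<in>UNIV. lam0 $ r + (\<Sum>l\<in>UNIV. C $ l) * \<mu> $ r)"
  proof (intro sum_mono add_mono)
    fix r
    show "lam $ r * f (n + axis r 1) \<le> lam0 $ r"
      using mult_left_le[OF f(2) lam(1)] lam(2) order_trans by blast
    have "0 \<le> alloc n r * \<mu> $ r"
      using alloc_nonneg[of n r] \<mu>_pos[of r] by simp
    then show "alloc n r * \<mu> $ r * f (n - axis r 1) \<le> (\<Sum>l\<in>UNIV. C $ l) * \<mu> $ r"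
      using mult_left_le[OF f(2)] alloc_rate_le order_trans by blast
  qed
  finally show ?thesis by (simp add: rate_bound_def)
qed

lemma flow_rate_nonneg: "(\<And>r. 0 \<le> lam $ r) \<Longrightarrow> 0 \<le> flow_rate lam \<mu> x i j"
  unfolding flow_rate_def using x_nonneg \<mu>_pos by (intro sum_nonneg) (auto simp: less_imp_le)

abbreviation perp :: "nat^'r \<Rightarrow> real^'r" where
  "perp n \<equiv> perp_part links \<kappa> lam0 \<mu> Ls (real_state n)"

abbreviation normsq :: "nat^'r \<Rightarrow> real" where
  "normsq n \<equiv> ip (real_state n) (real_state n)"

subsection \<open>Stationary moments\<close>

text \<open>The shift by \<open>1/\<epsilon>\<^sup>2\<close> makes \<open>\<epsilon> * radius \<epsilon> n \<ge> 1\<close>, so that lower powers of this quantity are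
  bounded by higher ones.\<close>

definition radius :: "real \<Rightarrow> nat^'r \<Rightarrow> real" where
  "radius \<epsilon> n = sqrt (normsq n + 1 / \<epsilon>\<^sup>2)"

section \<open>One-step changes of squared norms and the drift of their powers\<close>

lemma component_le: "sqrt (wt r) * \<bar>y $ r\<bar> \<le> sqrt (ip y y)"
proof -
  have nonneg: "0 \<le> wt i * y $ i * y $ i" for i
    using wt_pos[of i] by (simp only: mult.assoc) (intro mult_nonneg_nonneg zero_le_square less_imp_le)
  have "wt r * y $ r * y $ r \<le> ip y y"
    unfolding ip_eq using nonneg by (intro member_le_sum) auto
  then have "wt r * (y $ r)\<^sup>2 \<le> ip y y"
    by (simp only: power2_eq_square mult.assoc)
  then have "sqrt (wt r * (y $ r)\<^sup>2) \<le> sqrt (ip y y)" by (rule real_sqrt_le_mono)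
  then show ?thesis by (simp add: real_sqrt_mult)
qed

text \<open>With \<open>step_le\<close> it bounds the one-step change of a squared norm by a
  multiple of the norm, which makes it the constant \<open>D\<close> of
  \<open>power_Suc_add_le\<close>.\<close>

definition step_const :: real where
  "step_const = (\<Sum>r\<in>UNIV. 2 * sqrt (wt r) + wt r)"

lemma step_const_nonneg: "0 \<le> step_const"
  unfolding step_const_def using wt_pos[THEN less_imp_le] by (intro sum_nonneg add_nonneg_nonneg) auto

lemma step_le:
  assumes "ip y y \<le> X" "1 \<le> X"
  shows "2 * wt r * \<bar>y $ r\<bar> + wt r \<le> step_const * sqrt X"
proof -
  have w: "0 < sqrt (wt r)" "0 < wt r" using wt_pos[of r] by auto
  have "sqrt (wt r) * \<bar>y $ r\<bar> \<le> sqrt X"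
    using component_le[of r y] real_sqrt_le_mono[OF assms(1)] by linarith
  then have "2 * sqrt (wt r) * (sqrt (wt r) * \<bar>y $ r\<bar>) \<le> 2 * sqrt (wt r) * sqrt X"
    using w by (intro mult_left_mono) auto
  moreover have "2 * sqrt (wt r) * (sqrt (wt r) * \<bar>y $ r\<bar>) = 2 * wt r * \<bar>y $ r\<bar>"
  proof -
    have "sqrt (wt r) * sqrt (wt r) = wt r" using w by simp
    then show ?thesis by (metis mult.assoc)
  qed
  moreover have "wt r * 1 \<le> wt r * sqrt X"
    using assms(2) w by (intro mult_left_mono) auto
  ultimately have "2 * wt r * \<bar>y $ r\<bar> + wt r \<le> (2 * sqrt (wt r) + wt r) * sqrt X"
    by (simp only: distrib_right)
  also have "\<dots> \<le> step_const * sqrt X"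
    unfolding step_const_def using wt_pos[THEN less_imp_le] assms(2)
    by (intro mult_right_mono member_le_sum) (auto intro!: add_nonneg_nonneg)
  finally show ?thesis .
qed

lemma ip_add_axis: "ip (y + axis r c) (y + axis r c) = ip y y + (2 * wt r * c * y $ r + wt r * c\<^sup>2)"
proof -
  have ax: "ip (axis r c) z = wt r * c * z $ r" for z
    unfolding ip_eq by (subst sum.mono_neutral_cong_right[of UNIV "{r}"]) (auto simp: axis_def)
  have "ip (y + axis r c) (y + axis r c) = ip y y + 2 * ip (axis r c) y + ip (axis r c) (axis r c)"
    using w_inner_commute[of \<kappa> lam0 y "axis r c"] by (simp add: w_inner_add_left w_inner_add_right)
  then show ?thesis unfolding ax by (simp add: axis_def power2_eq_square)
qed

lemma real_state_up: "real_state (n + axis r 1) = real_state n + axis r 1"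
  by (simp add: real_state_def vec_eq_iff axis_def)

lemma real_state_down: "0 < n $ r \<Longrightarrow> real_state (n - axis r 1) = real_state n + axis r (- 1)"
  by (auto simp: real_state_def vec_eq_iff axis_def of_nat_diff)

text \<open>The \<epsilon>-term carries the weights \<kappa> because
  \<open>wt r * lam0 $ r = \<kappa> $ r\<close>.\<close>

lemma drift_direction:
  "(\<Sum>r\<in>UNIV. wt r * G $ r * (((1 - \<epsilon>) *\<^sub>R lam0) $ r - \<mu> $ r * alloc n r)) =
    ip G (imbalance n) - \<epsilon> * (\<Sum>r\<in>UNIV. \<kappa> $ r * G $ r)"
proof -
  have "wt r * G $ r * (((1 - \<epsilon>) *\<^sub>R lam0) $ r - \<mu> $ r * alloc n r) =
      wt r * G $ r * imbalance n $ r - \<epsilon> * (\<kappa> $ r * G $ r)" for r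
    using lam0_pos[of r] by (simp add: wt_def imbalance_def field_simps)
  then show ?thesis
    by (simp add: ip_eq sum_subtractf sum_distrib_left)
qed

text \<open>\<open>quadratic_growth X G n\<close> says that \<open>X\<close> changes in one step from \<open>n\<close> at most like a squared norm
  whose gradient at \<open>n\<close> is \<open>2 G\<close>.\<close>

definition quadratic_growth :: "(nat^'r \<Rightarrow> real) \<Rightarrow> real^'r \<Rightarrow> nat^'r \<Rightarrow> bool" where
  "quadratic_growth X G n \<longleftrightarrow> 1 \<le> X n \<and> (\<forall>m. 0 \<le> X m) \<and> ip G G \<le> X n \<and>
    (\<forall>r. X (n + axis r 1) \<le> X n + (2 * wt r * G $ r + wt r)) \<and>
    (\<forall>r. 0 < n $ r \<longrightarrow> X (n - axis r 1) \<le> X n + (- 2 * wt r * G $ r + wt r))"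

text \<open>Common to both Lyapunov functions: the terms with \<open>G\<close> add up to the drift
  along the gradient, while the remaining \<open>wt r\<close> and the expansion error, times bounded
  rates, are of order \<open>X n ^ k\<close>. \<open>K\<close> is chosen before \<epsilon>,
  \<open>X\<close>, \<open>G\<close> and \<open>n\<close>.\<close>

lemma power_drift_le:
  obtains K where "0 \<le> K" and
    "\<And>\<epsilon> X G n. \<lbrakk>0 < \<epsilon>; \<epsilon> < 1; quadratic_growth X G n\<rbrakk> \<Longrightarrow>
      ctmc_drift (flow_rate ((1 - \<epsilon>) *\<^sub>R lam0) \<mu> x) (\<lambda>m. X m ^ Suc k) n \<le>
      real (Suc k) * X n ^ k * (2 * (ip G (imbalance n) - \<epsilon> * (\<Sum>r\<in>UNIV. \<kappa> $ r * G $ r))) + K * X n ^ k"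
proof -
  obtain K0 where K0: "0 \<le> K0" and pow: "\<And>x d. \<lbrakk>1 \<le> x; \<bar>d\<bar> \<le> step_const * sqrt x; 0 \<le> x + d\<rbrakk> \<Longrightarrow>
      (x + d) ^ Suc k \<le> x ^ Suc k + real (Suc k) * x ^ k * d + K0 * x ^ k"
    using power_Suc_add_le[OF step_const_nonneg, of k] by blast
  define K where "K = (\<Sum>r\<in>UNIV. rate_bound r * (real (Suc k) * wt r + K0))"
  have B0: "0 \<le> rate_bound r" for r
    unfolding rate_bound_def using lam0_pos[of r] \<mu>_pos[of r] C_sum_nonneg
    by (intro add_nonneg_nonneg mult_nonneg_nonneg) (auto simp: less_imp_le)
  show thesis
  proof
    show "0 \<le> K"
      unfolding K_def using B0 K0 wt_pos
      by (intro sum_nonneg mult_nonneg_nonneg add_nonneg_nonneg) (auto simp: less_imp_le)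
    fix \<epsilon> :: real and X G n
    assume \<epsilon>: "0 < \<epsilon>" "\<epsilon> < 1" and "quadratic_growth X G n"
    then have X1: "1 \<le> X n" and X0: "\<And>m. 0 \<le> X m" and G_le: "ip G G \<le> X n"
      and up: "\<And>r. X (n + axis r 1) \<le> X n + (2 * wt r * G $ r + wt r)"
      and down: "\<And>r. 0 < n $ r \<Longrightarrow> X (n - axis r 1) \<le> X n + (- 2 * wt r * G $ r + wt r)"
      by (auto simp: quadratic_growth_def)
    define lam where "lam = (1 - \<epsilon>) *\<^sub>R lam0"
    have lam0: "0 \<le> lam $ r" and lam1: "lam $ r \<le> lam0 $ r" for r
      using \<epsilon> lam0_pos[of r] by (auto simp: lam_def mult_left_le_one_le)
    note step = step_le[OF G_le X1]
    define Y where "Y = X n ^ k"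
    have Y0: "0 \<le> Y" using X1 by (simp add: Y_def)
    have incr: "X m ^ Suc k - X n ^ Suc k \<le> real (Suc k) * Y * d + K0 * Y"
      if "X m \<le> X n + d" "\<bar>d\<bar> \<le> step_const * sqrt (X n)" for m d
    proof -
      have "X m ^ Suc k \<le> (X n + d) ^ Suc k"
        by (rule power_mono[OF that(1) X0])
      also have "\<dots> \<le> X n ^ Suc k + real (Suc k) * X n ^ k * d + K0 * X n ^ k"
        by (rule pow[OF X1 that(2)]) (use order_trans[OF X0 that(1)] in simp)
      finally show ?thesis by (simp add: Y_def)
    qed
    have abs_step: "\<bar>2 * wt r * G $ r + wt r\<bar> \<le> step_const * sqrt (X n)"
      "\<bar>- 2 * wt r * G $ r + wt r\<bar> \<le> step_const * sqrt (X n)" for r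
    proof -
      have "\<bar>2 * wt r * G $ r\<bar> = 2 * wt r * \<bar>G $ r\<bar>"
        using wt_pos[of r] by (simp only: abs_mult)
      with step[of r] wt_pos[of r] show "\<bar>2 * wt r * G $ r + wt r\<bar> \<le> step_const * sqrt (X n)"
        "\<bar>- 2 * wt r * G $ r + wt r\<bar> \<le> step_const * sqrt (X n)" by linarith+
    qed
    have term_le: "lam $ r * (X (n + axis r 1) ^ Suc k - X n ^ Suc k) +
        alloc n r * \<mu> $ r * (X (n - axis r 1) ^ Suc k - X n ^ Suc k) \<le>
        real (Suc k) * Y * (2 * (wt r * G $ r * (lam $ r - \<mu> $ r * alloc n r))) +
        rate_bound r * (real (Suc k) * wt r + K0) * Y" for r
    proof -
      have "lam $ r * (X (n + axis r 1) ^ Suc k - X n ^ Suc k) \<le>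
          lam $ r * (real (Suc k) * Y * (2 * wt r * G $ r + wt r) + K0 * Y)"
        by (intro mult_left_mono incr up abs_step lam0)
      moreover have "alloc n r * \<mu> $ r * (X (n - axis r 1) ^ Suc k - X n ^ Suc k) \<le>
          alloc n r * \<mu> $ r * (real (Suc k) * Y * (- 2 * wt r * G $ r + wt r) + K0 * Y)"
      proof (cases "0 < n $ r")
        case True
        then show ?thesis
          using alloc_nonneg[of n r] \<mu>_pos[of r]
          by (intro mult_left_mono incr down abs_step) auto
      qed (simp add: alloc_def)
      moreover have "(lam $ r + alloc n r * \<mu> $ r) * ((real (Suc k) * wt r + K0) * Y) \<le>
          rate_bound r * ((real (Suc k) * wt r + K0) * Y)"
      proof (rule mult_right_mono)
        show "lam $ r + alloc n r * \<mu> $ r \<le> rate_bound r"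
          unfolding rate_bound_def by (rule add_mono[OF lam1 alloc_rate_le])
        show "0 \<le> (real (Suc k) * wt r + K0) * Y"
          using K0 Y0 wt_pos[of r] by (intro mult_nonneg_nonneg add_nonneg_nonneg) auto
      qed
      moreover have "lam $ r * (real (Suc k) * Y * (2 * wt r * G $ r + wt r) + K0 * Y) +
          alloc n r * \<mu> $ r * (real (Suc k) * Y * (- 2 * wt r * G $ r + wt r) + K0 * Y) =
          real (Suc k) * Y * (2 * (wt r * G $ r * (lam $ r - \<mu> $ r * alloc n r))) +
          (lam $ r + alloc n r * \<mu> $ r) * ((real (Suc k) * wt r + K0) * Y)"
        by (simp only: ring_distribs mult_minus_left mult_minus_right diff_conv_add_uminus mult_ac)
      ultimately show ?thesis by (simp only: mult.assoc)
    qed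
    have "ctmc_drift (flow_rate lam \<mu> x) (\<lambda>m. X m ^ Suc k) n =
        (\<Sum>r\<in>UNIV. lam $ r * (X (n + axis r 1) ^ Suc k - X n ^ Suc k) +
        alloc n r * \<mu> $ r * (X (n - axis r 1) ^ Suc k - X n ^ Suc k))"
      by (simp only: ctmc_drift_flow_rate sum.distrib)
    also have "\<dots> \<le> (\<Sum>r\<in>UNIV. real (Suc k) * Y * (2 * (wt r * G $ r * (lam $ r - \<mu> $ r * alloc n r))) +
        rate_bound r * (real (Suc k) * wt r + K0) * Y)"
      by (intro sum_mono term_le)
    also have "\<dots> = real (Suc k) * Y * (2 * (\<Sum>r\<in>UNIV. wt r * G $ r * (lam $ r - \<mu> $ r * alloc n r))) + K * Y"
      by (simp only: sum.distrib sum_distrib_left[symmetric] sum_distrib_right[symmetric] K_def)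
    also have "(\<Sum>r\<in>UNIV. wt r * G $ r * (lam $ r - \<mu> $ r * alloc n r)) =
        ip G (imbalance n) - \<epsilon> * (\<Sum>r\<in>UNIV. \<kappa> $ r * G $ r)"
      unfolding lam_def by (rule drift_direction)
    finally show "ctmc_drift (flow_rate ((1 - \<epsilon>) *\<^sub>R lam0) \<mu> x) (\<lambda>m. X m ^ Suc k) n \<le>
      real (Suc k) * X n ^ k * (2 * (ip G (imbalance n) - \<epsilon> * (\<Sum>r\<in>UNIV. \<kappa> $ r * G $ r))) + K * X n ^ k"
      unfolding Y_def lam_def .
  qed
qed

text \<open>The removed projection lies in the cone and therefore pairs nonnegatively with the
  imbalance.\<close>

lemma ip_perp_imbalance_le: "ip (perp n) (imbalance n) \<le> ip (real_state n) (imbalance n)"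
  using ip_imbalance_cone[OF par_part_in_cone[of "real_state n"], of n]
  by (simp add: perp_part_def w_inner_diff_left)

text \<open>The old projection is a competitor for the distance of the new state to the cone, so
  one-sided quadratic growth follows without differentiating the projection.\<close>

lemma perp_change:
  assumes "real_state m = real_state n + axis r c"
  shows "ip (perp m) (perp m) \<le> ip (perp n) (perp n) + (2 * wt r * c * perp n $ r + wt r * c\<^sup>2)"
proof -
  have "real_state m - par_part links \<kappa> lam0 \<mu> Ls (real_state n) = perp n + axis r c"
    by (simp add: assms perp_part_def)
  then show ?thesis
    using perp_part_le[OF par_part_in_cone[of "real_state n"], of "real_state m"]
    by (simp only: ip_add_axis)
qed

section \<open>Comparison of weighted sums with the norm\<close>

lemma total_lower:
  obtains c where "0 < c" "\<And>n. c * sqrt (normsq n) \<le> total n"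
proof -
  obtain d where d: "0 < d" "\<And>r. d \<le> \<kappa> $ r / sqrt (wt r)"
    using finite_positive_lower_bound[of UNIV "\<lambda>r. \<kappa> $ r / sqrt (wt r)"] \<kappa>_pos wt_pos by auto
  have "d * sqrt (normsq n) \<le> total n" for n
  proof -
    have "sqrt (normsq n) = L2_set (\<lambda>r. sqrt (wt r) * real (n $ r)) UNIV"
      using wt_pos[THEN less_imp_le]
      by (simp add: L2_set_def ip_eq real_state_def power_mult_distrib) (simp add: power2_eq_square mult.assoc)
    also have "\<dots> \<le> (\<Sum>r\<in>UNIV. sqrt (wt r) * real (n $ r))"
      using wt_pos[THEN less_imp_le] by (intro L2_set_le_sum) auto
    finally have "d * sqrt (normsq n) \<le> (\<Sum>r\<in>UNIV. d * (sqrt (wt r) * real (n $ r)))"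
      using d by (simp add: sum_distrib_left[symmetric])
    also have "\<dots> \<le> (\<Sum>r\<in>UNIV. \<kappa> $ r / sqrt (wt r) * (sqrt (wt r) * real (n $ r)))"
      using d wt_pos[THEN less_imp_le] by (intro sum_mono mult_right_mono) auto
    also have "\<dots> = total n"
    proof (rule sum.cong)
      fix r
      have "sqrt (wt r) \<noteq> 0" using wt_pos[of r] by simp
      then show "\<kappa> $ r / sqrt (wt r) * (sqrt (wt r) * real (n $ r)) = \<kappa> $ r * real (n $ r)"
        by simp
    qed simp
    finally show ?thesis .
  qed
  with d(1) show thesis by (rule that)
qed

text \<open>Stated for arbitrary vectors, since it is also applied to \<open>perp n\<close>, which
  may have negative entries.\<close>

lemma weighted_sum_upper:
  obtains L where "0 < L" "\<And>y. \<bar>\<Sum>r\<in>UNIV. \<kappa> $ r * y $ r\<bar> \<le> L * sqrt (ip y y)"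
proof
  define L where "L = (\<Sum>r\<in>UNIV. \<kappa> $ r / sqrt (wt r))"
  show "0 < L" unfolding L_def using \<kappa>_pos wt_pos by (intro sum_pos) auto
  fix y
  have "\<bar>\<Sum>r\<in>UNIV. \<kappa> $ r * y $ r\<bar> \<le> (\<Sum>r\<in>UNIV. \<bar>\<kappa> $ r * y $ r\<bar>)"
    by (rule sum_abs)
  also have "\<dots> \<le> (\<Sum>r\<in>UNIV. \<kappa> $ r / sqrt (wt r) * sqrt (ip y y))"
  proof (rule sum_mono)
    fix r
    have w: "0 < sqrt (wt r)" using wt_pos[of r] by simp
    have "\<bar>\<kappa> $ r * y $ r\<bar> = \<kappa> $ r / sqrt (wt r) * (sqrt (wt r) * \<bar>y $ r\<bar>)"
      using \<kappa>_pos[of r] less_imp_neq[OF w] by (simp add: abs_mult)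
    also have "\<dots> \<le> \<kappa> $ r / sqrt (wt r) * sqrt (ip y y)"
      using \<kappa>_pos[of r] w by (intro mult_left_mono component_le) auto
    finally show "\<bar>\<kappa> $ r * y $ r\<bar> \<le> \<kappa> $ r / sqrt (wt r) * sqrt (ip y y)" .
  qed
  finally show "\<bar>\<Sum>r\<in>UNIV. \<kappa> $ r * y $ r\<bar> \<le> L * sqrt (ip y y)"
    by (simp add: L_def sum_distrib_right)
qed

lemma stationary_bound:
  fixes f g h :: "nat^'r \<Rightarrow> real"
  assumes \<epsilon>: "0 < \<epsilon>" "\<epsilon> < 1"
    and st: "ctmc_stationary (flow_rate ((1 - \<epsilon>) *\<^sub>R lam0) \<mu> x) \<pi>"
    and "\<And>n. 0 \<le> f n" "\<And>n. 0 \<le> g n" "\<And>n. 0 \<le> h n" "integrable (measure_pmf \<pi>) h"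
    and "\<And>n. ctmc_drift (flow_rate ((1 - \<epsilon>) *\<^sub>R lam0) \<mu> x) f n + g n \<le> h n"
  shows "integrable (measure_pmf \<pi>) g"
    and "measure_pmf.expectation \<pi> g \<le> measure_pmf.expectation \<pi> h"
proof -
  have lam: "0 \<le> ((1 - \<epsilon>) *\<^sub>R lam0) $ r" "((1 - \<epsilon>) *\<^sub>R lam0) $ r \<le> lam0 $ r" for r
    using \<epsilon> lam0_pos[of r] by (auto simp: mult_left_le_one_le)
  note * = st finite_flow_rate_support flow_rate_nonneg[OF lam(1)] exit_rate_le[OF lam] assms(4-8)
  show "integrable (measure_pmf \<pi>) g" by (rule stationary_moment_bound(1)[OF *])
  show "measure_pmf.expectation \<pi> g \<le> measure_pmf.expectation \<pi> h"
    by (rule stationary_moment_bound(2)[OF *])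
qed

section \<open>Bounds for the shifted radius and the two moment estimates\<close>

lemma radius_sq: "0 < \<epsilon> \<Longrightarrow> (radius \<epsilon> n)\<^sup>2 = normsq n + 1 / \<epsilon>\<^sup>2"
  unfolding radius_def using ip_nonneg[of "real_state n"] by (intro real_sqrt_pow2) auto

lemma radius_ge: 
  assumes "0 < \<epsilon>"
  shows "1 / \<epsilon> \<le> radius \<epsilon> n"
proof -
  have "sqrt ((1 / \<epsilon>)\<^sup>2) \<le> radius \<epsilon> n"
    unfolding radius_def using ip_nonneg[of "real_state n"]
    by (intro real_sqrt_le_mono) (simp add: power_one_over)
  then show ?thesis using assms by simp
qed

lemma scaled_radius_ge: "0 < \<epsilon> \<Longrightarrow> 1 \<le> \<epsilon> * radius \<epsilon> n"
  using radius_ge[of \<epsilon> n] by (simp add: field_simps)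

lemma sqrt_normsq_le_radius: "0 < \<epsilon> \<Longrightarrow> sqrt (normsq n) \<le> radius \<epsilon> n"
  unfolding radius_def by (intro real_sqrt_le_mono) simp

lemma radius_le: "0 < \<epsilon> \<Longrightarrow> radius \<epsilon> n \<le> sqrt (normsq n) + 1 / \<epsilon>"
  unfolding radius_def using sqrt_add_le_add_sqrt[of "normsq n" "1 / \<epsilon>\<^sup>2"] ip_nonneg[of "real_state n"]
  by (simp add: real_sqrt_divide)

text \<open>Lyapunov function \<open>radius \<epsilon> n ^ (2 * k + 2)\<close>. The imbalance term
  is nonpositive, and the \<epsilon>-term gives negative drift of order \<epsilon> times the power
  \<open>2 * k + 1\<close>, the power that \<open>perp_moment\<close> requires.\<close>

lemma radius_moment:
  obtains c where "0 < c" and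
    "\<And>\<epsilon> \<pi>. \<lbrakk>0 < \<epsilon>; \<epsilon> < 1; ctmc_stationary (flow_rate ((1 - \<epsilon>) *\<^sub>R lam0) \<mu> x) \<pi>\<rbrakk> \<Longrightarrow>
      integrable (measure_pmf \<pi>) (\<lambda>n. (\<epsilon> * radius \<epsilon> n) ^ (2 * k + 1)) \<and>
      measure_pmf.expectation \<pi> (\<lambda>n. (\<epsilon> * radius \<epsilon> n) ^ (2 * k + 1)) \<le> c"
proof -
  obtain K where K: "0 \<le> K" and drift: "\<And>\<epsilon> X G n. \<lbrakk>0 < \<epsilon>; \<epsilon> < 1; quadratic_growth X G n\<rbrakk> \<Longrightarrow>
      ctmc_drift (flow_rate ((1 - \<epsilon>) *\<^sub>R lam0) \<mu> x) (\<lambda>m. X m ^ Suc k) n \<le>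
      real (Suc k) * X n ^ k * (2 * (ip G (imbalance n) - \<epsilon> * (\<Sum>r\<in>UNIV. \<kappa> $ r * G $ r))) + K * X n ^ k"
    by (rule power_drift_le[of k]) (rule that)
  obtain c1 where c1: "0 < c1" "\<And>n. c1 * sqrt (normsq n) \<le> total n"
    by (rule total_lower) (rule that)
  \<comment> \<open>Half of the coefficient of the negative drift. The \<open>2 * a\<close> in
    \<open>B\<close> pays for replacing the norm by the radius through
    \<open>radius_le\<close>.\<close>
  define a where "a = real (Suc k) * c1"
  define B where "B = K + 2 * a"
  have a: "0 < a" using c1 by (simp add: a_def)
  have B: "0 < B" using a K by (simp add: B_def)
  show thesis
  proof (rule that[of "(B / a) ^ (2 * k + 1)"])
    show "0 < (B / a) ^ (2 * k + 1)" using a B by simp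
    fix \<epsilon> :: real and \<pi> :: "(nat^'r) pmf"
    assume \<epsilon>: "0 < \<epsilon>" "\<epsilon> < 1" and st: "ctmc_stationary (flow_rate ((1 - \<epsilon>) *\<^sub>R lam0) \<mu> x) \<pi>"
    let ?M = "radius \<epsilon>" and ?lam = "(1 - \<epsilon>) *\<^sub>R lam0"
    define X where "X n = (?M n)\<^sup>2" for n
    have X: "X n = normsq n + 1 / \<epsilon>\<^sup>2" for n using \<epsilon> by (simp add: X_def radius_sq)
    have M1: "1 \<le> ?M n" for n
      using radius_ge[of \<epsilon> n] \<epsilon> by (intro order_trans[OF _ radius_ge]) auto
    have M0: "0 < ?M n" for n using M1[of n] by linarith
    have X1: "1 \<le> X n" for n unfolding X_def using M1[of n] by (simp add: one_le_power)
    define g where "g n = a * \<epsilon> * ?M n ^ (2 * k + 1)" for n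
    define H where "H = B * (B / (a * \<epsilon>)) ^ (2 * k)"
    have main: "ctmc_drift (flow_rate ?lam \<mu> x) (\<lambda>m. X m ^ Suc k) n + g n \<le> H" for n
    proof -
      have "quadratic_growth X (real_state n) n"
        unfolding quadratic_growth_def
      proof (intro conjI allI impI)
        show "1 \<le> X n" by (rule X1)
        show "0 \<le> X m" for m using X1[of m] by linarith
        show "normsq n \<le> X n" by (simp add: X)
        show "X (n + axis r 1) \<le> X n + (2 * wt r * real_state n $ r + wt r)" for r
          unfolding X real_state_up ip_add_axis by simp
        show "X (n - axis r 1) \<le> X n + (- 2 * wt r * real_state n $ r + wt r)" if "0 < n $ r" for r
          unfolding X real_state_down[OF that] ip_add_axis by simp
      qed
      from drift[OF \<epsilon> this]
      have "ctmc_drift (flow_rate ?lam \<mu> x) (\<lambda>m. X m ^ Suc k) n \<le>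
          real (Suc k) * X n ^ k * (2 * (ip (real_state n) (imbalance n) - \<epsilon> * total n)) + K * X n ^ k"
        by (simp only: real_state_def vec_lambda_beta)
      also have "real (Suc k) * X n ^ k * (2 * (ip (real_state n) (imbalance n) - \<epsilon> * total n)) + K * X n ^ k \<le>
          real (Suc k) * X n ^ k * (2 * (c1 - \<epsilon> * c1 * ?M n)) + K * X n ^ k"
      proof -
        have "c1 * ?M n \<le> c1 * (sqrt (normsq n) + 1 / \<epsilon>)"
          using c1 radius_le[OF \<epsilon>(1), of n] by (intro mult_left_mono) auto
        also have "\<dots> \<le> total n + c1 / \<epsilon>" using c1(2)[of n] by (simp add: distrib_left)
        finally have "\<epsilon> * (c1 * ?M n) \<le> \<epsilon> * (total n + c1 / \<epsilon>)"
          using \<epsilon> by (intro mult_left_mono) auto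
        also have "\<dots> = \<epsilon> * total n + c1" using \<epsilon> by (simp add: distrib_left)
        finally have "ip (real_state n) (imbalance n) - \<epsilon> * total n \<le> c1 - \<epsilon> * c1 * ?M n"
          using ip_state_imbalance_nonpos[of n] by (simp add: mult.assoc)
        then show ?thesis
          using X1[of n] by (intro add_right_mono mult_left_mono) auto
      qed
      also have "\<dots> = B * X n ^ k - 2 * a * \<epsilon> * ?M n * X n ^ k"
        by (simp add: a_def B_def algebra_simps)
      also have "\<dots> = B * ?M n ^ (2 * k) - 2 * g n"
        by (simp add: g_def X_def power_mult[symmetric])
      \<comment> \<open>One half of the negative drift absorbs this term up to the constant
        \<open>H\<close>; the other half remains as \<open>g n\<close>.\<close>
      also have "B * ?M n ^ (2 * k) \<le> g n + H"
        using absorb_power[of "a * \<epsilon>" B 1 "?M n" "2 * k"] a B \<epsilon> M0[of n] by (simp add: g_def H_def)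
      finally show ?thesis by simp
    qed
    have g0: "0 \<le> g n" for n unfolding g_def using a \<epsilon> M0[of n] by simp
    have H0: "0 \<le> H" unfolding H_def using a B \<epsilon> by simp
    have X0: "0 \<le> X n ^ Suc k" for n using X1[of n] by simp
    have int_H: "integrable (measure_pmf \<pi>) (\<lambda>_. H)" by simp
    note bound = stationary_bound[OF \<epsilon> st X0 g0 H0 int_H main]
    have scaled: "(\<epsilon> * ?M n) ^ (2 * k + 1) = \<epsilon> ^ (2 * k) / a * g n" for n
      using a by (simp add: g_def power_mult_distrib)
    have "measure_pmf.expectation \<pi> (\<lambda>n. (\<epsilon> * ?M n) ^ (2 * k + 1)) = \<epsilon> ^ (2 * k) / a * measure_pmf.expectation \<pi> g"
      unfolding scaled using bound(1) by simp
    also have "\<dots> \<le> \<epsilon> ^ (2 * k) / a * H"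
      using bound(2) \<epsilon> a by (intro mult_left_mono) auto
    also have "\<dots> = (B / a) ^ (2 * k + 1)"
      using a \<epsilon> by (simp add: H_def power_divide power_mult_distrib)
    finally show "integrable (measure_pmf \<pi>) (\<lambda>n. (\<epsilon> * ?M n) ^ (2 * k + 1)) \<and>
      measure_pmf.expectation \<pi> (\<lambda>n. (\<epsilon> * ?M n) ^ (2 * k + 1)) \<le> (B / a) ^ (2 * k + 1)"
      unfolding scaled using bound(1) by simp
  qed
qed

text \<open>Lyapunov function \<open>X n ^ Suc k\<close>. With
  \<open>M = \<beta> / \<epsilon>\<close> and \<beta> at least 1, all errors become multiples of
  \<open>\<beta> ^ (2 * k + 1) / \<epsilon> ^ k\<close>, and \<open>radius_moment\<close> bounds the
  mean of this power of \<beta> uniformly.\<close>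

lemma perp_moment:
  obtains c where "0 < c" and
    "\<And>\<epsilon> \<pi>. \<lbrakk>0 < \<epsilon>; \<epsilon> < 1; ctmc_stationary (flow_rate ((1 - \<epsilon>) *\<^sub>R lam0) \<mu> x) \<pi>\<rbrakk> \<Longrightarrow>
      integrable (measure_pmf \<pi>) (\<lambda>n. (1 + ip (perp n) (perp n)) ^ k) \<and>
      measure_pmf.expectation \<pi> (\<lambda>n. (1 + ip (perp n) (perp n)) ^ k) \<le> c / \<epsilon> ^ k"
proof -
  obtain K where K: "0 \<le> K" and drift: "\<And>\<epsilon> X G n. \<lbrakk>0 < \<epsilon>; \<epsilon> < 1; quadratic_growth X G n\<rbrakk> \<Longrightarrow>
      ctmc_drift (flow_rate ((1 - \<epsilon>) *\<^sub>R lam0) \<mu> x) (\<lambda>m. X m ^ Suc k) n \<le>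
      real (Suc k) * X n ^ k * (2 * (ip G (imbalance n) - \<epsilon> * (\<Sum>r\<in>UNIV. \<kappa> $ r * G $ r))) + K * X n ^ k"
    by (rule power_drift_le[of k]) (rule that)
  obtain L where L: "0 < L" "\<And>y. \<bar>\<Sum>r\<in>UNIV. \<kappa> $ r * y $ r\<bar> \<le> L * sqrt (ip y y)"
    by (rule weighted_sum_upper) (rule that)
  obtain c2 where c2: "0 < c2" and near: "\<And>n. \<exists>k\<in>cone. ip (real_state n - k) (real_state n - k) \<le>
       c2 * total n * - ip (real_state n) (imbalance n)"
    by (rule near_cone) (rule that)
  obtain Cr where Cr: "0 < Cr" and radius_mom: "\<And>\<epsilon> \<pi>. \<lbrakk>0 < \<epsilon>; \<epsilon> < 1; ctmc_stationary (flow_rate ((1 - \<epsilon>) *\<^sub>R lam0) \<mu> x) \<pi>\<rbrakk> \<Longrightarrow>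
      integrable (measure_pmf \<pi>) (\<lambda>n. (\<epsilon> * radius \<epsilon> n) ^ (2 * k + 1)) \<and>
      measure_pmf.expectation \<pi> (\<lambda>n. (\<epsilon> * radius \<epsilon> n) ^ (2 * k + 1)) \<le> Cr"
    by (rule radius_moment[of k]) (rule that)
  define c where "c = c2 * L"
  have c: "0 < c" using c2 L by (simp add: c_def)
  \<comment> \<open>Here \<open>2 / c\<close> pays for replacing \<open>X n - 1\<close> by
    \<open>X n\<close>, \<open>c * L\<^sup>2\<close> for the \<epsilon>-term, and \<open>K\<close>
    for the second-order error.\<close>
  define K2 where "K2 = real (Suc k) * (2 / c + c * L\<^sup>2) + K"
  have K2: "0 < K2" unfolding K2_def using c L K by (intro add_pos_nonneg mult_pos_pos) auto
  \<comment> \<open>The drift contains \<open>- 2 * a * X n ^ Suc k / M\<close>: one half absorbs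
    \<open>K2 * \<beta> * X n ^ k\<close>, the other yields the term \<open>a * X n ^ k\<close> to
    be estimated.\<close>
  define a where "a = real (Suc k) / c / 2"
  have a: "0 < a" using c by (simp add: a_def)
  define C3 where "C3 = K2 * (K2 / a) ^ k + a"
  have C3: "0 < C3" unfolding C3_def using K2 a by (intro add_nonneg_pos) auto
  show thesis
  proof (rule that[of "C3 / a * Cr"])
    show "0 < C3 / a * Cr" using C3 a Cr by simp
    fix \<epsilon> :: real and \<pi> :: "(nat^'r) pmf"
    assume \<epsilon>: "0 < \<epsilon>" "\<epsilon> < 1" and st: "ctmc_stationary (flow_rate ((1 - \<epsilon>) *\<^sub>R lam0) \<mu> x) \<pi>"
    let ?M = "radius \<epsilon>" and ?lam = "(1 - \<epsilon>) *\<^sub>R lam0"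
    define b where "b n = \<epsilon> * ?M n" for n
    define X where "X n = 1 + ip (perp n) (perp n)" for n
    have X1: "1 \<le> X n" for n using ip_nonneg[of "perp n"] by (simp add: X_def)
    have b1: "1 \<le> b n" for n unfolding b_def by (rule scaled_radius_ge[OF \<epsilon>(1)])
    have M_b: "?M n = b n / \<epsilon>" for n using \<epsilon> by (simp add: b_def)
    have b_M: "b n \<le> ?M n" for n
      using b1[of n] \<epsilon> unfolding M_b by (simp add: le_divide_eq mult_left_le)
    have M1: "1 \<le> ?M n" for n using b1[of n] b_M[of n] by linarith
    define h where "h n = C3 / \<epsilon> ^ k * b n ^ (2 * k + 1)" for n
    have main: "ctmc_drift (flow_rate ?lam \<mu> x) (\<lambda>m. X m ^ Suc k) n + a * X n ^ k \<le> h n" for n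
    proof -
      define M where "M = ?M n"
      define \<beta> where "\<beta> = b n"
      define I where "I = - ip (real_state n) (imbalance n)"
      have M: "1 \<le> M" "0 < M" using M1[of n] by (auto simp: M_def)
      have \<beta>: "1 \<le> \<beta>" "\<epsilon> * M = \<beta>" "M = \<beta> / \<epsilon>"
        unfolding M_def \<beta>_def by (rule b1) (simp only: b_def, rule M_b)
      have "quadratic_growth X (perp n) n"
        unfolding quadratic_growth_def
      proof (intro conjI allI impI)
        show "1 \<le> X n" by (rule X1)
        show "0 \<le> X m" for m using X1[of m] by linarith
        show "ip (perp n) (perp n) \<le> X n" by (simp add: X_def)
        show "X (n + axis r 1) \<le> X n + (2 * wt r * perp n $ r + wt r)" for r
          using perp_change[OF real_state_up, of n r] by (simp add: X_def)
        show "X (n - axis r 1) \<le> X n + (- 2 * wt r * perp n $ r + wt r)" if "0 < n $ r" for r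
          using perp_change[OF real_state_down[OF that]] by (simp add: X_def)
      qed
      from drift[OF \<epsilon> this]
      have "ctmc_drift (flow_rate ?lam \<mu> x) (\<lambda>m. X m ^ Suc k) n \<le>
          real (Suc k) * X n ^ k * (2 * (ip (perp n) (imbalance n) - \<epsilon> * (\<Sum>r\<in>UNIV. \<kappa> $ r * perp n $ r))) + K * X n ^ k" .
      also have "real (Suc k) * X n ^ k * (2 * (ip (perp n) (imbalance n) - \<epsilon> * (\<Sum>r\<in>UNIV. \<kappa> $ r * perp n $ r))) + K * X n ^ k
          \<le> real (Suc k) * X n ^ k * (- X n / (c * M) + (2 / c + c * L\<^sup>2) * \<beta>) + K * \<beta> * X n ^ k"
      proof -
        have "X n - 1 \<le> c * M * I"
        proof -
          obtain y where y: "y \<in> cone" "ip (real_state n - y) (real_state n - y) \<le> c2 * total n * I"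
            using near[of n] unfolding I_def by blast
          have "I \<ge> 0" using ip_state_imbalance_nonpos[of n] by (simp add: I_def)
          have "total n \<le> L * sqrt (normsq n)"
            using L(2)[of "real_state n"] by (simp add: real_state_def abs_le_iff)
          also have "\<dots> \<le> L * M"
            unfolding M_def using L sqrt_normsq_le_radius[OF \<epsilon>(1)] by (intro mult_left_mono) auto
          finally have "c2 * total n * I \<le> c2 * (L * M) * I"
            using c2 \<open>I \<ge> 0\<close> by (intro mult_right_mono mult_left_mono) auto
          with perp_part_le[OF y(1), of "real_state n"] y(2) show ?thesis
            by (simp add: X_def c_def mult.assoc)
        qed
        then have "X n / (c * M) - 1 / (c * M) \<le> I"
          using c M by (simp add: diff_divide_distrib[symmetric] divide_le_eq mult.commute)
        moreover have "1 / (c * M) \<le> 1 / c * \<beta>"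
        proof -
          have "1 / (c * M) \<le> 1 / c"
            using c M by (intro divide_left_mono) (auto simp: mult_le_cancel_left1)
          also have "\<dots> \<le> 1 / c * \<beta>"
            using mult_left_mono[OF \<beta>(1), of "1 / c"] c by simp
          finally show ?thesis .
        qed
        ultimately have I: "X n / (c * M) - 1 / c * \<beta> \<le> I" by linarith
        have "- (\<epsilon> * (\<Sum>r\<in>UNIV. \<kappa> $ r * perp n $ r)) \<le> \<epsilon> * (L * sqrt (X n))"
        proof -
          have "- (\<Sum>r\<in>UNIV. \<kappa> $ r * perp n $ r) \<le> L * sqrt (ip (perp n) (perp n))"
            using L(2)[of "perp n"] by linarith
          also have "\<dots> \<le> L * sqrt (X n)"
            using L by (intro mult_left_mono real_sqrt_le_mono) (auto simp: X_def)
          finally have "\<epsilon> * - (\<Sum>r\<in>UNIV. \<kappa> $ r * perp n $ r) \<le> \<epsilon> * (L * sqrt (X n))"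
            using \<epsilon> by (intro mult_left_mono) auto
          then show ?thesis by simp
        qed
        \<comment> \<open>Young's inequality, with weights chosen so that it consumes half of the
          negative term \<open>X n / (c * M)\<close>; \<open>\<epsilon> * \<epsilon> * M\<close> is
          at most \<beta>.\<close>
        also have "\<epsilon> * (L * sqrt (X n)) \<le> X n / (2 * c * M) + c * L\<^sup>2 / 2 * \<beta>"
        proof -
          have "0 \<le> (sqrt (X n) - c * M * \<epsilon> * L)\<^sup>2" by simp
          also have "\<dots> = X n - 2 * (c * M) * (\<epsilon> * (L * sqrt (X n))) + (c * M) * (c * L\<^sup>2 * (\<epsilon> * (\<epsilon> * M)))"
            using X1[of n] by (simp add: power2_eq_square algebra_simps)
          also have "(c * M) * (c * L\<^sup>2 * (\<epsilon> * (\<epsilon> * M))) \<le> (c * M) * (c * L\<^sup>2 * \<beta>)"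
            using c M \<epsilon> \<beta> by (intro mult_left_mono) (auto simp: mult_left_le_one_le)
          finally have "2 * (c * M) * (\<epsilon> * (L * sqrt (X n))) \<le> X n + (c * M) * (c * L\<^sup>2 * \<beta>)" by simp
          then show ?thesis using c M by (simp add: field_simps)
        qed
        finally have perp_sum: "- (\<epsilon> * (\<Sum>r\<in>UNIV. \<kappa> $ r * perp n $ r)) \<le> X n / (2 * c * M) + c * L\<^sup>2 / 2 * \<beta>" .
        have "2 * (ip (perp n) (imbalance n) - \<epsilon> * (\<Sum>r\<in>UNIV. \<kappa> $ r * perp n $ r)) \<le>
            2 * (- (X n / (c * M) - 1 / c * \<beta>) + X n / (2 * c * M) + c * L\<^sup>2 / 2 * \<beta>)"
          using perp_sum ip_perp_imbalance_le[of n] I unfolding I_def by argo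
        also have "\<dots> = - X n / (c * M) + (2 / c + c * L\<^sup>2) * \<beta>"
          using c M by (simp add: field_simps)
        finally show ?thesis
          using X1[of n] K \<beta> by (intro add_mono mult_left_mono mult_right_mono) (auto simp: mult_le_cancel_left1)
      qed
      also have "\<dots> = K2 * \<beta> * X n ^ k - 2 * (a * X n ^ Suc k / M)"
        using c M by (simp add: K2_def a_def field_simps)
      also have "K2 * \<beta> * X n ^ k \<le> a * X n ^ Suc k / M + K2 * \<beta> * (K2 * \<beta> * M / a) ^ k"
        using a K2 \<beta> M X1[of n] by (intro absorb_power) auto
      \<comment> \<open>Substituting \<open>M = \<beta> / \<epsilon>\<close> shows the origin of the
        exponent: one \<beta> in front and two in each of the \<open>k\<close> factors.\<close>
      also have "K2 * \<beta> * (K2 * \<beta> * M / a) ^ k = K2 * (K2 / a) ^ k / \<epsilon> ^ k * \<beta> ^ (2 * k + 1)"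
        unfolding \<beta>(3) using \<epsilon>
        by (simp add: power_mult_distrib power_divide power_mult power2_eq_square mult_ac)
      finally have "ctmc_drift (flow_rate ?lam \<mu> x) (\<lambda>m. X m ^ Suc k) n \<le>
          K2 * (K2 / a) ^ k / \<epsilon> ^ k * \<beta> ^ (2 * k + 1) - a * X n ^ Suc k / M"
        by simp
      moreover have "a * X n ^ k \<le> a * X n ^ Suc k / M + a / \<epsilon> ^ k * \<beta> ^ (2 * k + 1)"
      proof -
        have "a * X n ^ k \<le> a * X n ^ Suc k / M + a * M ^ k"
          using absorb_power[of a a M "X n" k] a M X1[of n] by simp
        moreover have "\<beta> ^ k \<le> \<beta> ^ (2 * k + 1)" using \<beta> by (intro power_increasing) auto
        then have "a / \<epsilon> ^ k * \<beta> ^ k \<le> a / \<epsilon> ^ k * \<beta> ^ (2 * k + 1)"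
          using a \<epsilon> by (intro mult_left_mono) auto
        moreover have "a * M ^ k = a / \<epsilon> ^ k * \<beta> ^ k" unfolding \<beta>(3) by (simp add: power_divide)
        ultimately show ?thesis by linarith
      qed
      moreover have "h n = K2 * (K2 / a) ^ k / \<epsilon> ^ k * \<beta> ^ (2 * k + 1) + a / \<epsilon> ^ k * \<beta> ^ (2 * k + 1)"
        by (simp only: h_def C3_def \<beta>_def add_divide_distrib distrib_right)
      ultimately show ?thesis by linarith
    qed
    have X0: "0 \<le> X n ^ Suc k" "0 \<le> a * X n ^ k" for n using X1[of n] a by auto
    have h0: "0 \<le> h n" for n
      unfolding h_def using C3 \<epsilon> b1[of n] by simp
    have int_b: "integrable (measure_pmf \<pi>) (\<lambda>n. b n ^ (2 * k + 1))"
      and E_b: "measure_pmf.expectation \<pi> (\<lambda>n. b n ^ (2 * k + 1)) \<le> Cr"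
      using radius_mom[OF \<epsilon> st] by (auto simp: b_def)
    have int_h: "integrable (measure_pmf \<pi>) h"
      unfolding h_def using int_b by (rule integrable_mult_right)
    note bound = stationary_bound[OF \<epsilon> st X0 h0 int_h main]
    have int_X: "integrable (measure_pmf \<pi>) (\<lambda>n. X n ^ k)"
      using bound(1) a by simp
    have "a * measure_pmf.expectation \<pi> (\<lambda>n. X n ^ k) \<le> measure_pmf.expectation \<pi> h"
      using bound(2) by simp
    also have "\<dots> = C3 / \<epsilon> ^ k * measure_pmf.expectation \<pi> (\<lambda>n. b n ^ (2 * k + 1))"
      unfolding h_def by (rule integral_mult_right_zero)
    also have "\<dots> \<le> C3 / \<epsilon> ^ k * Cr"
      using E_b C3 \<epsilon> by (intro mult_left_mono) auto
    finally have "measure_pmf.expectation \<pi> (\<lambda>n. X n ^ k) \<le> C3 / a * Cr / \<epsilon> ^ k"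
      using a \<epsilon> by (simp add: field_simps)
    with int_X show "integrable (measure_pmf \<pi>) (\<lambda>n. (1 + ip (perp n) (perp n)) ^ k) \<and>
      measure_pmf.expectation \<pi> (\<lambda>n. (1 + ip (perp n) (perp n)) ^ k) \<le> C3 / a * Cr / \<epsilon> ^ k"
      by (simp add: X_def)
  qed
qed

text \<open>\<open>t \<le> 1 + t\<^sup>2\<close> for the rescaled norm power \<open>t\<close>
  reduces all exponents, odd ones included, to the moment of order \<open>m\<close> of the squared
  norm.\<close>

lemma perp_norm_moment:
  obtains c where
    "\<And>\<epsilon> \<pi>. \<lbrakk>0 < \<epsilon>; \<epsilon> < 1; ctmc_stationary (flow_rate ((1 - \<epsilon>) *\<^sub>R lam0) \<mu> x) \<pi>\<rbrakk> \<Longrightarrow>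
      integrable (measure_pmf \<pi>) (\<lambda>n. w_norm \<kappa> lam0 (perp n) ^ m) \<and>
      measure_pmf.expectation \<pi> (\<lambda>n. w_norm \<kappa> lam0 (perp n) ^ m) \<le> c * (1 / sqrt \<epsilon>) ^ m"
proof -
  obtain c where c: "0 < c" and mom: "\<And>\<epsilon> \<pi>. \<lbrakk>0 < \<epsilon>; \<epsilon> < 1; ctmc_stationary (flow_rate ((1 - \<epsilon>) *\<^sub>R lam0) \<mu> x) \<pi>\<rbrakk> \<Longrightarrow>
      integrable (measure_pmf \<pi>) (\<lambda>n. (1 + ip (perp n) (perp n)) ^ m) \<and>
      measure_pmf.expectation \<pi> (\<lambda>n. (1 + ip (perp n) (perp n)) ^ m) \<le> c / \<epsilon> ^ m"
    by (rule perp_moment[of m]) (rule that)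
  show thesis
  proof (rule that[of "1 + c"])
    fix \<epsilon> :: real and \<pi> :: "(nat^'r) pmf"
    assume \<epsilon>: "0 < \<epsilon>" "\<epsilon> < 1" and st: "ctmc_stationary (flow_rate ((1 - \<epsilon>) *\<^sub>R lam0) \<mu> x) \<pi>"
    define X where "X n = 1 + ip (perp n) (perp n)" for n
    define s where "s = (1 / sqrt \<epsilon>) ^ m"
    have s: "0 < s" using \<epsilon> by (simp add: s_def)
    have int: "integrable (measure_pmf \<pi>) (\<lambda>n. X n ^ m)"
      and E: "measure_pmf.expectation \<pi> (\<lambda>n. X n ^ m) \<le> c / \<epsilon> ^ m"
      using mom[OF \<epsilon> st] by (auto simp: X_def)
    have int_rhs: "integrable (measure_pmf \<pi>) (\<lambda>n. s * (1 + \<epsilon> ^ m * X n ^ m))"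
      using int by simp
    have w0: "0 \<le> w_norm \<kappa> lam0 (perp n)" for n
      by (simp add: w_norm_def ip_nonneg)
    have le: "w_norm \<kappa> lam0 (perp n) ^ m \<le> s * (1 + \<epsilon> ^ m * X n ^ m)" for n
    proof -
      define t where "t = (sqrt \<epsilon> * w_norm \<kappa> lam0 (perp n)) ^ m"
      have "t \<le> 1 + t\<^sup>2"
        using zero_le_power2[of "t - 1 / 2"] by (simp add: power2_eq_square algebra_simps)
      also have "t\<^sup>2 = \<epsilon> ^ m * ip (perp n) (perp n) ^ m"
      proof -
        have "t\<^sup>2 = ((sqrt \<epsilon> * w_norm \<kappa> lam0 (perp n))\<^sup>2) ^ m"
          by (simp only: t_def power_mult[symmetric] mult.commute)
        also have "(sqrt \<epsilon> * w_norm \<kappa> lam0 (perp n))\<^sup>2 = \<epsilon> * ip (perp n) (perp n)"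
          using \<epsilon> by (simp add: power_mult_distrib w_norm_def ip_nonneg)
        finally show ?thesis by (simp add: power_mult_distrib)
      qed
      also have "\<dots> \<le> \<epsilon> ^ m * X n ^ m"
        using \<epsilon> ip_nonneg[of "perp n"] by (intro mult_left_mono power_mono) (auto simp: X_def)
      finally have "s * t \<le> s * (1 + \<epsilon> ^ m * X n ^ m)"
        using s by (intro mult_left_mono) auto
      moreover have "s * t = w_norm \<kappa> lam0 (perp n) ^ m"
        using \<epsilon> by (simp add: s_def t_def power_mult_distrib power_divide)
      ultimately show ?thesis by simp
    qed
    have int_w: "integrable (measure_pmf \<pi>) (\<lambda>n. w_norm \<kappa> lam0 (perp n) ^ m)"
      by (rule Bochner_Integration.integrable_bound[OF int_rhs])
         (use w0 in \<open>auto intro!: AE_I2 order_trans[OF le]\<close>)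
    have "measure_pmf.expectation \<pi> (\<lambda>n. w_norm \<kappa> lam0 (perp n) ^ m) \<le>
        measure_pmf.expectation \<pi> (\<lambda>n. s * (1 + \<epsilon> ^ m * X n ^ m))"
      by (intro integral_mono int_w int_rhs le)
    also have "\<dots> = s * (1 + \<epsilon> ^ m * measure_pmf.expectation \<pi> (\<lambda>n. X n ^ m))"
      using int by simp
    also have "\<dots> \<le> s * (1 + \<epsilon> ^ m * (c / \<epsilon> ^ m))"
      using E s \<epsilon> by (intro mult_left_mono add_left_mono) auto
    also have "\<dots> = (1 + c) * s" using \<epsilon> by simp
    finally show "integrable (measure_pmf \<pi>) (\<lambda>n. w_norm \<kappa> lam0 (perp n) ^ m) \<and>
      measure_pmf.expectation \<pi> (\<lambda>n. w_norm \<kappa> lam0 (perp n) ^ m) \<le> (1 + c) * (1 / sqrt \<epsilon>) ^ m"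
      using int_w by (simp add: s_def)
  qed
qed

end

theorem theorem1:
  fixes links :: "'r::finite \<Rightarrow> 'l::finite set"
    and C :: "real^'l"
    and \<kappa> \<mu> lam0 :: "real^'r"
    and Ls :: "'l set"
    and x :: "nat^'r \<Rightarrow> real^'r"
    and \<pi> :: "real \<Rightarrow> (nat^'r) pmf"
    and m :: nat
  assumes "\<And>l. C $ l > 0"
    and "\<And>r. links r \<noteq> {}"
    and "rank (routing_matrix links) = CARD('l)"
    and "\<And>r. \<kappa> $ r > 0"
    and "\<And>r. \<mu> $ r > 0"
    and "\<And>r. lam0 $ r > 0"
    and "Ls \<noteq> {}"
    and "\<And>l. l \<in> Ls \<Longrightarrow> (\<Sum>r | l \<in> links r. lam0 $ r / \<mu> $ r) = C $ l"
    and "\<And>l. l \<notin> Ls \<Longrightarrow> (\<Sum>r | l \<in> links r. lam0 $ r / \<mu> $ r) < C $ l"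
    and "weighted_proportionally_fair links C \<kappa> x"
    and "\<And>\<epsilon>. 0 < \<epsilon> \<Longrightarrow> \<epsilon> < 1 \<Longrightarrow> ctmc_stationary (flow_rate ((1 - \<epsilon>) *\<^sub>R lam0) \<mu> x) (\<pi> \<epsilon>)"
  shows "(\<forall>\<^sub>F \<epsilon> in at_right 0.
            integrable (measure_pmf (\<pi> \<epsilon>))
              (\<lambda>n. w_norm \<kappa> lam0 (perp_part links \<kappa> lam0 \<mu> Ls (real_state n)) ^ m)) \<and>
         (\<lambda>\<epsilon>. measure_pmf.expectation (\<pi> \<epsilon>)
              (\<lambda>n. w_norm \<kappa> lam0 (perp_part links \<kappa> lam0 \<mu> Ls (real_state n)) ^ m))
           \<in> O[at_right 0](\<lambda>\<epsilon>. (1 / sqrt \<epsilon>) ^ m)"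
proof -
  interpret pf_network links C \<kappa> \<mu> lam0 Ls x
    by unfold_locales (use assms in auto)
  obtain c where c: "\<And>\<epsilon> \<pi>. \<lbrakk>0 < \<epsilon>; \<epsilon> < 1; ctmc_stationary (flow_rate ((1 - \<epsilon>) *\<^sub>R lam0) \<mu> x) \<pi>\<rbrakk> \<Longrightarrow>
      integrable (measure_pmf \<pi>) (\<lambda>n. w_norm \<kappa> lam0 (perp n) ^ m) \<and>
      measure_pmf.expectation \<pi> (\<lambda>n. w_norm \<kappa> lam0 (perp n) ^ m) \<le> c * (1 / sqrt \<epsilon>) ^ m"
    by (rule perp_norm_moment[of m]) (rule that)
  have ev: "\<forall>\<^sub>F \<epsilon> in at_right 0. 0 < \<epsilon> \<and> \<epsilon> < (1::real)"
    by (auto simp: eventually_at_right_field intro!: exI[of _ 1])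
  have nonneg: "0 \<le> measure_pmf.expectation p (\<lambda>n. w_norm \<kappa> lam0 (perp n) ^ m)" for p
    by (simp add: w_norm_def ip_nonneg)
  show ?thesis
  proof (intro conjI bigoI[where c=c])
    show "\<forall>\<^sub>F \<epsilon> in at_right 0.
        integrable (measure_pmf (\<pi> \<epsilon>)) (\<lambda>n. w_norm \<kappa> lam0 (perp n) ^ m)"
      using ev by eventually_elim (use c assms(11) in blast)
    show "\<forall>\<^sub>F \<epsilon> in at_right 0.
        norm (measure_pmf.expectation (\<pi> \<epsilon>) (\<lambda>n. w_norm \<kappa> lam0 (perp n) ^ m)) \<le>
        c * norm ((1 / sqrt \<epsilon>) ^ m)"
      using ev
    proof eventually_elim
      case (elim \<epsilon>)
      then have "norm ((1 / sqrt \<epsilon>) ^ m) = (1 / sqrt \<epsilon>) ^ m" by simp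
      with c[of \<epsilon> "\<pi> \<epsilon>"] assms(11)[of \<epsilon>] elim nonneg[of "\<pi> \<epsilon>"] show ?case by simp
    qed
  qed
qed

end
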